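(* Let $(X,\trianglelefteq)$ be a parallel ordered locale satisfying (C-$\vee$). For $U\in\mathcal{O}X$ let $J^-(U)$ be the collection of sieves $R$ on $\Downarrow U$ in the poset $\mathcal{O}X$ (identified with down-closed sets of elements below $\Downarrow U$) defined by $$R\in J^-(U)\quad\Longleftrightarrow\quad\bigvee R\in\mathrm{Cov}^-_{\trianglelefteq}(U).$$ Then $J^-$ is a $\Downarrow$-Grothendieck topology on $\mathcal{O}X$.
   Context: A locale $X$ is given by a frame $\mathcal{O}X$ (order $\sqsubseteq$, bottom $\varnothing$). An ordered locale $(X,\trianglelefteq)$ is a locale with a preorder $\trianglelefteq$ on $\mathcal{O}X$ such that $U_i\trianglelefteq V_i$ for all $i\in I$ implies $\bigvee_iU_i\trianglelefteq\bigvee_iV_i$. Cones: $\Uparrow U=\bigvee\{V:U\trianglelefteq V\}$, $\Downarrow U=\bigvee\{W:W\trianglelefteq U\}$. (C-$\vee$): $\Uparrow,\Downarrow$ preserve arbitrary joins. Parallel ordered: (i) $U\sqsubseteq V\trianglelefteq V'$ implies there is $U'$ with $U\trianglelefteq U'\sqsubseteq V'$; (ii) $V\trianglelefteq V'$ and $U'\sqsubseteq V'$ imply there is $U\sqsubseteq V$ with $U\trianglelefteq U'$; (iii) $U\trianglelefteq\varnothing$ or $\varnothing\trianglelefteq U$ implies $U=\varnothing$. A path is a finite sequence $p=(p_n)_{n=0}^N$ of nonempty ($\neq\varnothing$) elements of $\mathcal{O}X$ with $p_n\trianglelefteq p_{n+1}$; its endpoint is $p_\top=p_N$. It lands in $U$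 if $p_\top\sqsubseteq U$, and inhabits $A$ if $p_n\sqsubseteq A$ for some $n$. A path $q$ refines $p$, written $q\Subset p$, if for every $n$ there is $m$ with $q_m\sqsubseteq p_n$. For nonempty $W\sqsubseteq p_\top$ the restriction $p|_W$ is the path with $(p|_W)_N=W$ and $(p|_W)_n=p_n\wedge\Downarrow(p|_W)_{n+1}$ for $0\le n<N$. A local past refinement of $p$ is a family of paths $(q^j)_{j\in J}$ with $\bigvee_jq^j_\top=p_\top$ and $q^j\Subset p|_{q^j_\top}$ for all $j$. For $A,U\in\mathcal{O}X$: $A\in\mathrm{Cov}^-_{\trianglelefteq}(U)$ iff $A\sqsubseteq\Downarrow U$ and every path $p$ landing in $U$ has a local past refinement $(q^j)_j$ such that each $q^j$ inhabits $A$. Sieves: a sieve on an object $C$ of a category is a set of arrows with codomain $C$ closed under precomposition; $t_C$ is the maximal sieve; for $h\colon D\to C$ and a sieve $R$ on $C$, $h^*(R)=\{f: h\circ f\in R\}$. For a category $\mathbf{C}$, an endofunctor $T$ and a natural transformation $\mu\colon T^2\to T$, a $(T,\mu)$-Grothendieck topology is a function $J$ assigning to each object $C$ a collection $J(C)$ of sieves on $T(C)$ such that: (i) $t_{T(C)}\in J(C)$; (ii) if $S\in J(C)$ and $h\colon D\to C$ then $T(h)^*(S)\in J(D)$; (iii) if $S\in J(C)$ and $R$ is a sieve on $T(C)$ with $(\mu_C\circ T(h))^*(R)\in J(D)$ for all $h\colon D\to T(C)$ in $S$, then $R\in J(C)$. A $\Downarrow$-Grothendieck topology on the poset $\mathcal{O}X$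 is such a $J$ for $T=\Downarrow$ and $\mu$ given by $\Downarrow\Downarrow U=\Downarrow U$. *)

theory Defs
  imports Main
begin

section \<open>Frames and ordered locales\<close>

text \<open>The class \<open>complete_distrib_lattice\<close> of the library demands complete distributivity;
  a frame only satisfies the law below.\<close>

class frame = complete_lattice +
  assumes inf_Sup_frame: "inf a (Sup B) = Sup (inf a ` B)"

text \<open>A locale is given by its frame of opens, here the type \<open>'a\<close>. In \<open>ord_Sup\<close> the
  index sets have type \<open>('a \<times> 'a) set\<close>; this covers families of any index type, since a family of
  pairs \<open>(U i, V i)\<close> may be replaced by its range.\<close>

locale ordered_locale =
  fixes le :: "'a::frame \<Rightarrow> 'a \<Rightarrow> bool"  (infix \<open>\<unlhd>\<close> 50)
  assumes ord_refl: "U \<unlhd> U"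
    and ord_trans: "U \<unlhd> V \<Longrightarrow> V \<unlhd> W \<Longrightarrow> U \<unlhd> W"
    and ord_Sup: "\<And>(I :: ('a \<times> 'a) set) U V.
      (\<And>i. i \<in> I \<Longrightarrow> U i \<unlhd> V i) \<Longrightarrow> (SUP i\<in>I. U i) \<unlhd> (SUP i\<in>I. V i)"

locale parallel_ordered_locale = ordered_locale le
  for le :: "'a::frame \<Rightarrow> 'a \<Rightarrow> bool"  (infix \<open>\<unlhd>\<close> 50) +
  assumes lift_future: "U \<le> V \<Longrightarrow> V \<unlhd> V' \<Longrightarrow> \<exists>U'. U \<unlhd> U' \<and> U' \<le> V'"
    and lift_past: "V \<unlhd> V' \<Longrightarrow> U' \<le> V' \<Longrightarrow> \<exists>U. U \<le> V \<and> U \<unlhd> U'"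
    and bot_only: "U \<unlhd> bot \<or> bot \<unlhd> U \<Longrightarrow> U = bot"

definition future_cone :: "('a::frame \<Rightarrow> 'a \<Rightarrow> bool) \<Rightarrow> 'a \<Rightarrow> 'a" where
  "future_cone le U = Sup {V. le U V}"

definition past_cone :: "('a::frame \<Rightarrow> 'a \<Rightarrow> bool) \<Rightarrow> 'a \<Rightarrow> 'a" where
  "past_cone le U = Sup {W. le W U}"

text \<open>Condition (C-\<open>\<or>\<close>).\<close>

definition cones_preserve_joins :: "('a::frame \<Rightarrow> 'a \<Rightarrow> bool) \<Rightarrow> bool" where
  "cones_preserve_joins le \<longleftrightarrow>
    (\<forall>S. future_cone le (Sup S) = Sup (future_cone le ` S)) \<and>
    (\<forall>S. past_cone le (Sup S) = Sup (past_cone le ` S))"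

section \<open>Paths and causal coverage\<close>

text \<open>The path $p_0, \ldots, p_N$ is the nonempty list \<open>[p_0, ..., p_N]\<close>; its endpoint is
  \<open>last p\<close>.\<close>

definition is_path :: "('a::frame \<Rightarrow> 'a \<Rightarrow> bool) \<Rightarrow> 'a list \<Rightarrow> bool" where
  "is_path le p \<longleftrightarrow> p \<noteq> [] \<and> (\<forall>n<length p. p ! n \<noteq> bot) \<and>
    (\<forall>n. Suc n < length p \<longrightarrow> le (p ! n) (p ! Suc n))"

definition lands_in :: "'a::frame list \<Rightarrow> 'a \<Rightarrow> bool" where
  "lands_in p U \<longleftrightarrow> last p \<le> U"

definition inhabits :: "'a::frame list \<Rightarrow> 'a \<Rightarrow> bool" where
  "inhabits p A \<longleftrightarrow> (\<exists>n<length p. p ! n \<le> A)"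

definition path_refines :: "'a::frame list \<Rightarrow> 'a list \<Rightarrow> bool" where
  "path_refines q p \<longleftrightarrow> (\<forall>n<length p. \<exists>m<length q. q ! m \<le> p ! n)"

text \<open>\<open>path_restrict le p W\<close> is the restriction $p|_W$: the last entry is replaced by \<open>W\<close>, and,
  going backwards, $p_n$ by $p_n \wedge \mathord{\Downarrow} (p|_W)_{n+1}$. It is meant for
  nonempty \<open>W \<le> last p\<close>.\<close>

fun path_restrict :: "('a::frame \<Rightarrow> 'a \<Rightarrow> bool) \<Rightarrow> 'a list \<Rightarrow> 'a \<Rightarrow> 'a list" where
  "path_restrict le [] W = []"
| "path_restrict le [x] W = [W]"
| "path_restrict le (x # y # ps) W =
    (let r = path_restrict le (y # ps) W in inf x (past_cone le (hd r)) # r)"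

lemma length_path_restrict: "length (path_restrict le p W) = length p"
  by (induction le p W rule: path_restrict.induct) (auto simp: Let_def)

lemma path_restrict_last: "p \<noteq> [] \<Longrightarrow> path_restrict le p W ! (length p - 1) = W"
  by (induction le p W rule: path_restrict.induct) (auto simp: Let_def)

lemma path_restrict_nth:
  "Suc n < length p \<Longrightarrow>
    path_restrict le p W ! n = inf (p ! n) (past_cone le (path_restrict le p W ! Suc n))"
proof (induction le p W arbitrary: n rule: path_restrict.induct)
  case (3 le x y ps W)
  have "path_restrict le (y # ps) W \<noteq> []"
    using length_path_restrict[of le "y # ps" W] by auto
  with 3 show ?case by (cases n) (auto simp: Let_def hd_conv_nth)
qed auto

text \<open>A family of paths is represented by the set of its members: all conditions imposed on the
  family concern its members only.\<close>

definition local_past_refinement ::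
    "('a::frame \<Rightarrow> 'a \<Rightarrow> bool) \<Rightarrow> 'a list \<Rightarrow> 'a list set \<Rightarrow> bool" where
  "local_past_refinement le p Q \<longleftrightarrow>
    (\<forall>q\<in>Q. is_path le q) \<and> (SUP q\<in>Q. last q) = last p \<and>
    (\<forall>q\<in>Q. path_refines q (path_restrict le p (last q)))"

definition past_Cov :: "('a::frame \<Rightarrow> 'a \<Rightarrow> bool) \<Rightarrow> 'a \<Rightarrow> 'a set" where
  "past_Cov le U = {A. A \<le> past_cone le U \<and>
    (\<forall>p. is_path le p \<and> lands_in p U \<longrightarrow>
      (\<exists>Q. local_past_refinement le p Q \<and> (\<forall>q\<in>Q. inhabits q A)))}"

section \<open>Categories and sieves\<close>

text \<open>\<open>Comp C g f\<close> is $g \circ f$, meaningful when \<open>Cod C f = Dom C g\<close>.\<close>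

record ('o, 'm) cat =
  Obj :: "'o set"
  Arr :: "'m set"
  Dom :: "'m \<Rightarrow> 'o"
  Cod :: "'m \<Rightarrow> 'o"
  Id :: "'o \<Rightarrow> 'm"
  Comp :: "'m \<Rightarrow> 'm \<Rightarrow> 'm"

definition Hom :: "('o, 'm) cat \<Rightarrow> 'o \<Rightarrow> 'o \<Rightarrow> 'm set" where
  "Hom C a b = {f \<in> Arr C. Dom C f = a \<and> Cod C f = b}"

locale category =
  fixes C :: "('o, 'm) cat"
  assumes Dom_Obj: "f \<in> Arr C \<Longrightarrow> Dom C f \<in> Obj C"
    and Cod_Obj: "f \<in> Arr C \<Longrightarrow> Cod C f \<in> Obj C"
    and Id_Hom: "a \<in> Obj C \<Longrightarrow> Id C a \<in> Hom C a a"
    and Comp_Hom: "f \<in> Hom C a b \<Longrightarrow> g \<in> Hom C b c \<Longrightarrow> Comp C g f \<in> Hom C a c"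
    and Id_left: "f \<in> Hom C a b \<Longrightarrow> Comp C (Id C b) f = f"
    and Id_right: "f \<in> Hom C a b \<Longrightarrow> Comp C f (Id C a) = f"
    and Comp_assoc: "f \<in> Hom C a b \<Longrightarrow> g \<in> Hom C b c \<Longrightarrow> h \<in> Hom C c d \<Longrightarrow>
      Comp C h (Comp C g f) = Comp C (Comp C h g) f"

locale endofunctor = category C for C :: "('o, 'm) cat" +
  fixes To :: "'o \<Rightarrow> 'o" and Ta :: "'m \<Rightarrow> 'm"
  assumes To_Obj: "a \<in> Obj C \<Longrightarrow> To a \<in> Obj C"
    and Ta_Hom: "f \<in> Hom C a b \<Longrightarrow> Ta f \<in> Hom C (To a) (To b)"
    and Ta_Id: "a \<in> Obj C \<Longrightarrow> Ta (Id C a) = Id C (To a)"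
    and Ta_Comp: "f \<in> Hom C a b \<Longrightarrow> g \<in> Hom C b c \<Longrightarrow> Ta (Comp C g f) = Comp C (Ta g) (Ta f)"

definition is_sieve :: "('o, 'm) cat \<Rightarrow> 'o \<Rightarrow> 'm set \<Rightarrow> bool" where
  "is_sieve C c S \<longleftrightarrow> S \<subseteq> {f \<in> Arr C. Cod C f = c} \<and>
    (\<forall>f\<in>S. \<forall>g\<in>Arr C. Cod C g = Dom C f \<longrightarrow> Comp C f g \<in> S)"

definition max_sieve :: "('o, 'm) cat \<Rightarrow> 'o \<Rightarrow> 'm set" where
  "max_sieve C c = {f \<in> Arr C. Cod C f = c}"

definition pullback_sieve :: "('o, 'm) cat \<Rightarrow> 'm \<Rightarrow> 'm set \<Rightarrow> 'm set" where
  "pullback_sieve C h R = {f \<in> Arr C. Cod C f = Dom C h \<and> Comp C h f \<in> R}"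

text \<open>The parameter \<open>mu\<close> is a natural transformation from the square of the endofunctor
  \<open>(To, Ta)\<close> to that endofunctor.\<close>

locale T_mu_Grothendieck_topology = endofunctor C To Ta
  for C :: "('o, 'm) cat" and To :: "'o \<Rightarrow> 'o" and Ta :: "'m \<Rightarrow> 'm" +
  fixes mu :: "'o \<Rightarrow> 'm" and J :: "'o \<Rightarrow> 'm set set"
  assumes mu_Hom: "c \<in> Obj C \<Longrightarrow> mu c \<in> Hom C (To (To c)) (To c)"
    and mu_natural: "f \<in> Hom C a b \<Longrightarrow> Comp C (mu b) (Ta (Ta f)) = Comp C (Ta f) (mu a)"
    and J_sieve: "c \<in> Obj C \<Longrightarrow> S \<in> J c \<Longrightarrow> is_sieve C (To c) S"
    and J_max: "c \<in> Obj C \<Longrightarrow> max_sieve C (To c) \<in> J c"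
    and J_stable: "c \<in> Obj C \<Longrightarrow> S \<in> J c \<Longrightarrow> h \<in> Hom C d c \<Longrightarrow> pullback_sieve C (Ta h) S \<in> J d"
    and J_transitive: "c \<in> Obj C \<Longrightarrow> S \<in> J c \<Longrightarrow> is_sieve C (To c) R \<Longrightarrow>
      (\<And>d h. h \<in> S \<Longrightarrow> h \<in> Hom C d (To c) \<Longrightarrow>
        pullback_sieve C (Comp C (mu c) (Ta h)) R \<in> J d) \<Longrightarrow> R \<in> J c"

section \<open>The poset of opens as a category\<close>

text \<open>The unique arrow \<open>U \<rightarrow> V\<close> for \<open>U \<le> V\<close> is the pair \<open>(U, V)\<close>.\<close>

definition poset_cat :: "('a::order, 'a \<times> 'a) cat" where
  "poset_cat = \<lparr>Obj = UNIV, Arr = {(U, V). U \<le> V}, Dom = fst, Cod = snd,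
    Id = (\<lambda>U. (U, U)), Comp = (\<lambda>g f. (fst f, snd g))\<rparr>"

lemma category_poset_cat: "category poset_cat"
  by unfold_locales (auto simp: poset_cat_def Hom_def)

text \<open>A sieve on \<open>U\<close> corresponds to the set of domains of its arrows, a down-closed set of
  elements below \<open>U\<close>.\<close>

lemma is_sieve_poset_cat_iff:
  "is_sieve poset_cat U R \<longleftrightarrow>
    (\<exists>D. R = D \<times> {U} \<and> (\<forall>V\<in>D. V \<le> U \<and> (\<forall>W\<le>V. W \<in> D)))"
proof
  assume R: "is_sieve poset_cat U R"
  have closed: "(W, U) \<in> R" if "(V, U) \<in> R" "W \<le> V" for V W
    using R that unfolding is_sieve_def poset_cat_def by fastforce
  have "R = fst ` R \<times> {U}" "\<And>V. V \<in> fst ` R \<Longrightarrow> V \<le> U"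
    using R unfolding is_sieve_def poset_cat_def by force+
  moreover from this(1) have "W \<in> fst ` R" if "V \<in> fst ` R" "W \<le> V" for V W
    using closed[of V W] that by (metis SigmaI fst_conv image_eqI singletonI)
  ultimately show "\<exists>D. R = D \<times> {U} \<and> (\<forall>V\<in>D. V \<le> U \<and> (\<forall>W\<le>V. W \<in> D))"
    by blast
next
  assume "\<exists>D. R = D \<times> {U} \<and> (\<forall>V\<in>D. V \<le> U \<and> (\<forall>W\<le>V. W \<in> D))"
  then show "is_sieve poset_cat U R"
    unfolding is_sieve_def poset_cat_def by auto
qed

text \<open>The past cone is viewed as an endofunctor, with $\mu_U$ the identity
  $\mathord{\Downarrow}\mathord{\Downarrow} U = \mathord{\Downarrow} U$.\<close>

definition past_Grothendieck_topology ::
    "('a::frame \<Rightarrow> 'a \<Rightarrow> bool) \<Rightarrow> ('a \<Rightarrow> ('a \<times> 'a) set set) \<Rightarrow> bool" where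
  "past_Grothendieck_topology le J \<longleftrightarrow>
    T_mu_Grothendieck_topology poset_cat (past_cone le)
      (\<lambda>(U, V). (past_cone le U, past_cone le V))
      (\<lambda>U. (past_cone le (past_cone le U), past_cone le U)) J"

definition past_J :: "('a::frame \<Rightarrow> 'a \<Rightarrow> bool) \<Rightarrow> 'a \<Rightarrow> ('a \<times> 'a) set set" where
  "past_J le U = {R. is_sieve poset_cat (past_cone le U) R \<and> Sup (fst ` R) \<in> past_Cov le U}"

end

theory Submission
  imports Defs "HOL-Library.Multiset" "HOL-Library.Sublist"
begin

text \<open>Only transitivity is difficult. Refinement of paths does not respect order: a refinement \<open>q\<close> of
  \<open>p\<close> may visit the opens of \<open>p\<close> in a different order, and then \<open>q\<close> restricted to a smaller
  endpoint \<open>W\<close> need not refine \<open>p|\<^sub>W\<close>. So local past refinements cannot simply be composed. Covering in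
  a weak sense, where only refinement of \<open>p\<close> itself is demanded, is plainly transitive, and the point
  is that weak covering implies covering.

  Suppose that the endpoints of the paths which inhabit \<open>A\<close> and refine \<open>p\<close> strongly do not join to
  \<open>p_N\<close>, and separate their join from \<open>p_N\<close> by a prime filter \<open>x\<close>. Consider filters \<open>F_l\<close>
  containing \<open>p_l\<close> which form a causal chain, in some order, ending in \<open>x\<close>. Weak covering replaces such a
  chain by one of larger filters, in a possibly different order, together with a filter
  containing \<open>A\<close>. By Zorn's lemma the letters \<open>l = N-1, ..., 0\<close> can be added one at a time such
  that the filters chosen so far are maximal, hence are reproduced unchanged by weak covering.
  Since \<open>p\<close> leads from the new letter to the head of the old chain, and from there through the rest
  of it, every \<open>F_l\<close> sees one route that passes both through the later members of the chain and through
  \<open>p_{l+1}, ..., p_{N-1}\<close> in this order. Opens chosen from the \<open>F_l\<close> along these finite routes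
  then form a path which inhabits \<open>A\<close>, refines the restriction of \<open>p\<close> to its own endpoint,
  and has that endpoint in \<open>x\<close>: a contradiction.\<close>

section \<open>Auxiliary facts on frames and permutations of lists\<close>

lemma inf_sup_frame: "inf a (sup b c) = sup (inf a b) (inf a (c :: 'a::frame))"
  using inf_Sup_frame[of a "{b, c}"] by simp

text \<open>Lifts a permutation of values to a permutation of their labels; this matters when
  different labels carry the same value.\<close>

lemma mset_eq_map_obtain:
  assumes "mset ys = mset (map f xs)"
  obtains zs where "mset zs = mset xs" "ys = map f zs"
proof -
  have "\<exists>zs. mset zs = mset xs \<and> ys = map f zs"
    using assms
  proof (induction ys arbitrary: xs)
    case (Cons y ys)
    then have "y \<in> set (map f xs)" by (metis list.set_intros(1) set_mset_mset)
    then obtain us z vs where "xs = us @ z # vs" "y = f z" by (auto dest: split_list)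
    moreover then have "mset ys = mset (map f (us @ vs))" using Cons.prems by simp
    then obtain zs where "mset zs = mset (us @ vs)" "ys = map f zs" using Cons.IH by blast
    ultimately show ?case by (intro exI[of _ "z # zs"]) simp
  qed simp
  then show thesis using that by blast
qed

lemma finite_mset_eq: "finite {ys. mset ys = mset xs}"
proof (rule finite_subset)
  show "finite {ys. set ys \<subseteq> set xs \<and> length ys = length xs}"
    by (rule finite_lists_length_eq) simp
qed (auto dest: mset_eq_setD mset_eq_length)

locale join_cones = parallel_ordered_locale le
  for le :: "'a::frame \<Rightarrow> 'a \<Rightarrow> bool"  (infix \<open>\<unlhd>\<close> 50) +
  assumes cones: "cones_preserve_joins le"
begin

abbreviation up :: "'a \<Rightarrow> 'a" where "up \<equiv> future_cone le"
abbreviation dn :: "'a \<Rightarrow> 'a" where "dn \<equiv> past_cone le"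

section \<open>Cones\<close>

lemma up_Sup: "up (Sup S) = Sup (up ` S)" and dn_Sup: "dn (Sup S) = Sup (dn ` S)"
  using cones by (auto simp: cones_preserve_joins_def)

lemma up_mono: "U \<le> V \<Longrightarrow> up U \<le> up V"
  using up_Sup[of "{U, V}"] by (simp add: sup.absorb2 sup.orderI) (metis sup.absorb2 sup_ge1)

lemma dn_mono: "U \<le> V \<Longrightarrow> dn U \<le> dn V"
  using dn_Sup[of "{U, V}"] by (simp add: sup.absorb2 sup.orderI) (metis sup.absorb2 sup_ge1)

lemma up_bot: "up bot = bot"
  using up_Sup[of "{}"] by simp

lemma up_ge: "U \<le> up U" and dn_ge: "U \<le> dn U"
  unfolding future_cone_def past_cone_def by (auto intro: Sup_upper ord_refl)

lemma ord_le_dn: "V \<unlhd> W \<Longrightarrow> V \<le> dn W" and ord_le_up: "V \<unlhd> W \<Longrightarrow> W \<le> up V"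
  unfolding future_cone_def past_cone_def by (auto intro: Sup_upper)

lemma up_top: "up top = top"
  using up_ge[of top] by (simp add: top_unique)

text \<open>The join axiom for all pairs \<open>(V, W)\<close> with \<open>V \<unlhd> W\<close>;
  reflexivity keeps this family nonempty, so the join of the targets is \<open>W\<close>.\<close>

lemma dn_ord: "dn W \<unlhd> W"
proof -
  let ?I = "{(V, W') |V W'. V \<unlhd> W \<and> W' = W}"
  have "(SUP i\<in>?I. fst i) \<unlhd> (SUP i\<in>?I. snd i)"
    by (rule ord_Sup) auto
  moreover have "fst ` ?I = {V. V \<unlhd> W}" by force
  moreover have "snd ` ?I = {W}" using ord_refl[of W] by force
  ultimately show ?thesis by (simp add: past_cone_def)
qed

lemma ord_up: "W \<unlhd> up W"
proof -
  let ?I = "{(W', V) |V W'. W \<unlhd> V \<and> W' = W}"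
  have "(SUP i\<in>?I. fst i) \<unlhd> (SUP i\<in>?I. snd i)"
    by (rule ord_Sup) auto
  moreover have "snd ` ?I = {V. W \<unlhd> V}" by force
  moreover have "fst ` ?I = {W}" using ord_refl[of W] by force
  ultimately show ?thesis by (simp add: future_cone_def)
qed

lemma dn_idem: "dn (dn W) = dn W"
  by (meson antisym dn_ge dn_ord ord_le_dn ord_trans)

lemma up_idem: "up (up W) = up W"
  by (meson antisym up_ge ord_up ord_le_up ord_trans)

text \<open>Lifting \<open>V\<close> along \<open>dn W \<unlhd> W\<close> reaches an open inside
  both \<open>W\<close> and \<open>up V\<close>. This Frobenius-type rule allows a target to be cut
  down to what is reachable.\<close>

lemma le_dn_inf_up: "V \<le> dn W \<Longrightarrow> V \<le> dn (inf W (up V))"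
  by (meson dn_mono dn_ord inf.boundedI lift_future ord_le_dn ord_le_up order_trans)

lemma le_up_inf_dn: "V \<le> up W \<Longrightarrow> V \<le> up (inf W (dn V))"
  by (meson up_mono ord_up inf.boundedI lift_past ord_le_dn ord_le_up order_trans)

text \<open>For the converse, the two lifting axioms give one relation starting in \<open>V\<close>
  and one ending in \<open>W\<close>; their join is \<open>V \<unlhd> W\<close>.\<close>

lemma ord_iff: "V \<unlhd> W \<longleftrightarrow> V \<le> dn W \<and> W \<le> up V"
proof (intro iffI conjI)
  assume "V \<le> dn W \<and> W \<le> up V"
  then obtain V' W' where *: "V \<unlhd> W'" "W' \<le> W" "V' \<le> V" "V' \<unlhd> W"
    using dn_ord ord_up lift_future lift_past by metis
  have "(SUP i\<in>{(V, W'), (V', W)}. fst i) \<unlhd> (SUP i\<in>{(V, W'), (V', W)}. snd i)"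
    by (rule ord_Sup) (use * in auto)
  then show "V \<unlhd> W" using * by (simp add: sup.absorb1 sup.absorb2)
qed (auto intro: ord_le_dn ord_le_up)

text \<open>Serves to build paths backwards: the source shrinks while the target stays
  whole.\<close>

lemma inf_dn_ord: "X \<le> up Y \<Longrightarrow> inf Y (dn X) \<unlhd> X"
  by (simp add: ord_iff le_up_inf_dn)

lemma up_inf_dn: "inf b (up a) \<le> up (inf a (dn b))"
  by (meson dn_mono inf.cobounded1 inf.cobounded2 inf_mono le_up_inf_dn order_refl order_trans up_mono)

lemma path_le_up:
  assumes "is_path le q" "i \<le> j" "j < length q"
  shows "q ! j \<le> up (q ! i)"
  using assms(2,3)
proof (induction j rule: dec_induct)
  case base then show ?case by (simp add: up_ge)
next
  case (step j)
  then have "q ! j \<unlhd> q ! Suc j" using assms(1) by (simp add: is_path_def)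
  then show ?case using step ord_le_up up_mono up_idem by (metis Suc_lessD order_trans)
qed

lemma path_le_dn:
  assumes "is_path le q" "i \<le> j" "j < length q"
  shows "q ! i \<le> dn (q ! j)"
  using assms(2,3)
proof (induction j rule: dec_induct)
  case base then show ?case by (simp add: dn_ge)
next
  case (step j)
  then have "q ! j \<unlhd> q ! Suc j" using assms(1) by (simp add: is_path_def)
  then show ?case using step ord_le_dn dn_mono dn_idem by (metis Suc_lessD order_trans)
qed

section \<open>Forward and backward chains of opens\<close>

text \<open>In points: \<open>reach c Os\<close> is the set of ends of chains that start in \<open>c\<close> and visit \<open>Os\<close> in turn;
  \<open>route zs T\<close> is the set of points from which a chain visits \<open>zs\<close> in turn and ends in \<open>T\<close>.\<close>

fun reach :: "'a \<Rightarrow> 'a list \<Rightarrow> 'a" where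
  "reach c [] = c"
| "reach c (A # As) = reach (inf A (up c)) As"

fun route :: "'a list \<Rightarrow> 'a \<Rightarrow> 'a" where
  "route [] T = dn T"
| "route (z # zs) T = dn (inf z (route zs T))"

lemma reach_append: "reach c (As @ Bs) = reach (reach c As) Bs"
  by (induction As arbitrary: c) auto

lemma reach_mono: "c \<le> c' \<Longrightarrow> list_all2 (\<le>) As Bs \<Longrightarrow> reach c As \<le> reach c' Bs"
proof (induction As arbitrary: c c' Bs)
  case (Cons A As)
  then obtain B Bs' where "Bs = B # Bs'" "A \<le> B" "list_all2 (\<le>) As Bs'"
    by (auto simp: list_all2_Cons1)
  moreover have "inf A (up c) \<le> inf B (up c')"
    using calculation Cons.prems by (intro inf_mono up_mono)
  ultimately show ?case using Cons.IH by simp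
qed simp

lemma reach_mono1: "c \<le> c' \<Longrightarrow> reach c As \<le> reach c' As"
  by (rule reach_mono) (auto simp: list_all2_refl)

lemma reach_Sup: "reach (Sup S) As = (SUP c\<in>S. reach c As)"
proof (induction As arbitrary: S)
  case (Cons A As)
  have "inf A (up (Sup S)) = Sup ((\<lambda>c. inf A (up c)) ` S)"
    by (simp add: up_Sup inf_Sup_frame image_image)
  then show ?case using Cons.IH[of "(\<lambda>c. inf A (up c)) ` S"] by (simp add: image_image)
qed simp

lemma up_reach_le: "up (reach c As) \<le> up c"
proof (induction As arbitrary: c)
  case (Cons A As)
  have "up (inf A (up c)) \<le> up c" by (metis inf.cobounded2 up_idem up_mono)
  then show ?case using Cons[of "inf A (up c)"] by simp
qed simp

text \<open>The start enters a nonempty chain only through its future cone, so comparison up to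
  \<open>up\<close> suffices.\<close>

lemma up_reach_mono: "c \<le> up c' \<Longrightarrow> up (reach c As) \<le> up (reach c' As)"
proof (cases As)
  case Nil
  assume "c \<le> up c'"
  then show ?thesis using Nil up_mono[of c "up c'"] by (simp add: up_idem)
next
  case (Cons A As')
  assume "c \<le> up c'"
  then have "up c \<le> up c'" using up_mono[of c "up c'"] by (simp add: up_idem)
  then show ?thesis using Cons by (auto intro!: up_mono reach_mono1 inf_mono)
qed

lemma route_mono: "T \<le> T' \<Longrightarrow> route zs T \<le> route zs T'"
  by (induction zs) (auto intro!: dn_mono inf_mono)

lemma dn_route: "dn (route zs T) = route zs T"
  by (cases zs) (auto simp: dn_idem)

text \<open>A route may forget stops and enlarge the remaining ones. Forgetting is harmless because
  routes are closed under \<open>dn\<close>.\<close>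

lemma route_emb: "list_emb (\<lambda>A z. z \<le> A) As zs \<Longrightarrow> route zs T \<le> route As T"
proof (induction rule: list_emb.induct)
  case (list_emb_Nil zs)
  show ?case
  proof (induction zs)
    case (Cons z zs)
    have "dn (inf z (route zs T)) \<le> dn (route zs T)" by (simp add: dn_mono)
    then show ?case using Cons by (simp add: dn_route)
  qed simp
next
  case (list_emb_Cons xs ys y)
  have "dn (inf y (route ys T)) \<le> dn (route ys T)" by (simp add: dn_mono)
  then show ?case using list_emb_Cons by (simp add: dn_route)
next
  case (list_emb_Cons2 x y xs ys)
  then show ?case by (auto intro!: dn_mono inf_mono)
qed

text \<open>A route through \<open>zs\<close> also visits \<open>Bs\<close> in order, so its end
  lies in the future of \<open>reach X Bs\<close> as well as in \<open>T\<close>.\<close>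

lemma route_reach:
  assumes "X \<le> route zs T" "list_emb (\<lambda>B z. z \<le> B) Bs zs"
  shows "X \<le> route zs (inf T (up (reach X Bs)))"
  using assms
proof (induction zs arbitrary: X Bs)
  case Nil
  then have "Bs = []" by (cases Bs) auto
  moreover have "X \<le> dn (inf T (up X))" using Nil by (simp add: le_dn_inf_up)
  ultimately show ?case by simp
next
  case (Cons z zs)
  \<comment> \<open>The start is moved to the first stop \<open>z\<close>, which either is skipped
    by \<open>Bs\<close> or matches its head.\<close>
  define X' where "X' = inf (inf z (route zs T)) (up X)"
  have X': "X \<le> dn X'" unfolding X'_def using Cons.prems(1) le_dn_inf_up by simp
  have "X' \<le> route zs (inf T (up (reach X Bs)))"
  proof (cases "list_emb (\<lambda>B z. z \<le> B) Bs zs")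
    case True
    have "X' \<le> route zs (inf T (up (reach X' Bs)))"
      by (rule Cons.IH) (use True in \<open>auto simp: X'_def le_infI1\<close>)
    also have "\<dots> \<le> route zs (inf T (up (reach X Bs)))"
      by (intro route_mono inf_mono up_reach_mono) (auto simp: X'_def)
    finally show ?thesis .
  next
    case False
    then obtain B Bs' where B: "Bs = B # Bs'" "z \<le> B" "list_emb (\<lambda>B z. z \<le> B) Bs' zs"
      using Cons.prems(2) by (auto elim: list_emb.cases)
    have "X' \<le> route zs (inf T (up (reach X' Bs')))"
      by (rule Cons.IH) (use B in \<open>auto simp: X'_def le_infI1\<close>)
    also have "\<dots> \<le> route zs (inf T (up (reach X Bs)))"
      using B by (auto intro!: route_mono inf_mono up_mono reach_mono1
        simp: X'_def le_infI1 intro: order_trans)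
    finally show ?thesis .
  qed
  moreover have "X' \<le> z" by (simp add: X'_def le_infI1)
  ultimately show ?case using X' by (simp add: dn_mono order_trans)
qed

text \<open>Built backwards from \<open>T\<close>: each earlier entry is the part of the reachable
  open that lies in the past of the next entry. It is nonempty by \<open>bot_only\<close>.\<close>

lemma path_through:
  assumes "T \<noteq> bot" "T \<le> up (reach top As)"
  shows "\<exists>c. is_path le c \<and> length c = Suc (length As) \<and> last c = T \<and>
    (\<forall>i<length As. c ! i \<le> reach top (take (Suc i) As))"
  using assms
proof (induction As arbitrary: T rule: rev_induct)
  case Nil
  then show ?case by (intro exI[of _ "[T]"]) (auto simp: is_path_def)
next
  case (snoc A As)
  define Y where "Y = reach top (As @ [A])"
  define X where "X = inf Y (dn T)"
  have XT: "X \<unlhd> T" using snoc.prems unfolding X_def Y_def by (intro inf_dn_ord)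
  then have "X \<noteq> bot" using bot_only snoc.prems(1) ord_le_up up_bot by (metis bot.extremum_uniqueI)
  moreover have "X \<le> up (reach top As)" by (simp add: X_def Y_def reach_append le_infI1)
  ultimately obtain c where c: "is_path le c" "length c = Suc (length As)" "last c = X"
    "\<forall>i<length As. c ! i \<le> reach top (take (Suc i) As)"
    using snoc.IH by metis
  have last: "c ! length As = X" using c by (metis diff_Suc_1 last_conv_nth length_0_conv nat.simps(3))
  have "is_path le (c @ [T])"
    using c XT snoc.prems(1) last by (auto simp: is_path_def nth_append less_Suc_eq)
  moreover have "(c @ [T]) ! i \<le> reach top (take (Suc i) (As @ [A]))" if "i < length (As @ [A])" for i
  proof (cases "i < length As")
    case True
    then show ?thesis using c by (simp add: nth_append)
  next
    case False
    then have "i = length As" using that by simp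
    then show ?thesis using c last by (simp add: nth_append X_def Y_def)
  qed
  ultimately show ?case using c by (intro exI[of _ "c @ [T]"]) auto
qed

lemma path_restrict_le:
  assumes "p \<noteq> []" "W \<le> last p" "n < length p"
  shows "path_restrict le p W ! n \<le> p ! n"
proof (cases "Suc n < length p")
  case True
  then show ?thesis using path_restrict_nth[of n p le W] by simp
next
  case False
  then have "n = length p - 1" using assms by simp
  then show ?thesis using assms path_restrict_last[of p le W] by (simp add: last_conv_nth)
qed

section \<open>Unordered coverage\<close>

text \<open>In points: below every point of \<open>U\<close>, a chain through \<open>As\<close> can be replaced by one that also
  visits \<open>A\<close>, but the members of \<open>As\<close> may be visited in a different order.\<close>

definition weak_cover :: "'a \<Rightarrow> 'a \<Rightarrow> bool" where
  "weak_cover A U \<longleftrightarrow> (\<forall>As W. W \<le> U \<longrightarrow>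
    inf W (up (reach top As)) \<le> (SUP Bs\<in>{Bs. mset Bs = mset (A # As)}. up (reach top Bs)))"

text \<open>The path \<open>q\<close> is itself a chain visiting the opens in order of position;
  equal positions do no harm since \<open>up\<close> is inflationary.\<close>

lemma le_up_reach_sorted:
  assumes "is_path le q" "q ! k \<le> up c" "k < length q"
    "sorted (map fst xs)" "\<forall>(m, B)\<in>set xs. k \<le> m \<and> m < length q \<and> q ! m \<le> B"
  shows "last q \<le> up (reach c (map snd xs))"
  using assms(2-)
proof (induction xs arbitrary: k c)
  case Nil
  have "last q \<le> up (q ! k)"
    using path_le_up[OF assms(1), of k "length q - 1"] Nil
    by (cases "q = []") (auto simp: last_conv_nth)
  also have "\<dots> \<le> up c" using Nil up_mono up_idem by metis
  finally show ?case by simp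
next
  case (Cons x xs)
  obtain m B where x: "x = (m, B)" by (cases x)
  have "q ! m \<le> up (q ! k)" using path_le_up[OF assms(1), of k m] Cons x by auto
  then have "q ! m \<le> up c" using Cons.prems(1) up_mono up_idem by (metis order_trans)
  then have "q ! m \<le> inf B (up c)" using Cons x by auto
  then have "last q \<le> up (reach (inf B (up c)) (map snd xs))"
    using Cons x by (intro Cons.IH[of m]) (auto intro: order_trans[OF _ up_ge])
  then show ?case using x by simp
qed

text \<open>A path through \<open>As\<close> is refined by paths that meet \<open>A\<close> and
  every member of \<open>As\<close>; the positions at which they do so dictate the new
  order.\<close>

lemma past_Cov_weak_cover:
  assumes "A \<in> past_Cov le U"
  shows "weak_cover A U"
  unfolding weak_cover_def
proof (intro allI impI)
  fix As :: "'a list" and W assume "W \<le> U"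
  define X where "X = inf W (up (reach top As))"
  let ?S = "SUP Bs\<in>{Bs. mset Bs = mset (A # As)}. up (reach top Bs)"
  show "X \<le> ?S"
  proof (cases "X = bot")
    case False
    obtain p where p: "is_path le p" "length p = Suc (length As)" "last p = X"
      "\<forall>i<length As. p ! i \<le> reach top (take (Suc i) As)"
      using path_through[OF False, of As] by (auto simp: X_def)
    have p_le: "p ! i \<le> As ! i" if "i < length As" for i
    proof -
      have "reach top (take (Suc i) As) \<le> As ! i"
        using that by (simp add: take_Suc_conv_app_nth reach_append)
      then show ?thesis using p(4) that order_trans by blast
    qed
    have "lands_in p U" using p \<open>W \<le> U\<close> by (simp add: lands_in_def X_def le_infI1)
    then obtain Q where Q: "local_past_refinement le p Q" "\<forall>q\<in>Q. inhabits q A"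
      using assms p(1) unfolding past_Cov_def by blast
    have "last q \<le> ?S" if "q \<in> Q" for q
    proof -
      have q: "is_path le q" "path_refines q (path_restrict le p (last q))" "inhabits q A"
        using Q that by (auto simp: local_past_refinement_def)
      have "last q \<le> last p"
        using Q that unfolding local_past_refinement_def by (metis SUP_upper)
      then have "\<exists>m<length q. q ! m \<le> As ! i" if "i < length As" for i
        using q(2) path_restrict_le[of p "last q" i] p p_le[OF that] that
        unfolding path_refines_def length_path_restrict
        by (metis Suc_length_conv less_SucI list.distinct(1) order_trans)
      then have "\<forall>B\<in>set (A # As). \<exists>m<length q. q ! m \<le> B"
        using q(3) by (auto simp: inhabits_def in_set_conv_nth)
      then obtain m where m: "\<forall>B\<in>set (A # As). m B < length q \<and> q ! m B \<le> B" by metis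
      \<comment> \<open>Sorting by the time of visit produces the permutation of
        \<open>A # As\<close>.\<close>
      define xs where "xs = sort_key fst (map (\<lambda>B. (m B, B)) (A # As))"
      have "q \<noteq> []" using q(1) by (simp add: is_path_def)
      moreover have "sorted (map fst xs)" unfolding xs_def by (rule sorted_sort_key)
      moreover have "set xs = (\<lambda>B. (m B, B)) ` set (A # As)"
        unfolding xs_def set_sort by simp
      ultimately have "last q \<le> up (reach top (map snd xs))"
        using m by (intro le_up_reach_sorted[OF q(1), of 0]) (auto simp: up_top)
      moreover have "mset (map snd xs) = mset (A # As)"
        unfolding xs_def mset_map mset_sort by (simp add: comp_def flip: mset_map)
      ultimately show ?thesis by (meson SUP_upper2 mem_Collect_eq)
    qed
    then show ?thesis
      using Q(1) p(3) by (metis (no_types, lifting) SUP_least local_past_refinement_def)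
  qed simp
qed

lemma weak_cover_mono:
  assumes "weak_cover A U" "A \<le> B"
  shows "weak_cover B U"
  unfolding weak_cover_def
proof (intro allI impI)
  fix As :: "'a list" and W assume "W \<le> U"
  have "up (reach top Bs) \<le> (SUP Bs\<in>{Bs. mset Bs = mset (B # As)}. up (reach top Bs))"
    if Bs: "mset Bs = mset (A # As)" for Bs
  proof -
    have "A \<in> set Bs" using Bs by (metis list.set_intros(1) set_mset_mset)
    then obtain xs ys where xy: "Bs = xs @ A # ys" by (meson split_list)
    then have "mset (xs @ B # ys) = mset (B # As)" using Bs by simp
    moreover have "up (reach top Bs) \<le> up (reach top (xs @ B # ys))"
      using xy assms(2) by (auto intro!: up_mono reach_mono simp: list_all2_append list_all2_refl)
    ultimately show ?thesis by (meson SUP_upper2 mem_Collect_eq)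
  qed
  then have "(SUP Bs\<in>{Bs. mset Bs = mset (A # As)}. up (reach top Bs))
      \<le> (SUP Bs\<in>{Bs. mset Bs = mset (B # As)}. up (reach top Bs))"
    by (intro SUP_least) auto
  then show "inf W (up (reach top As)) \<le> (SUP Bs\<in>{Bs. mset Bs = mset (B # As)}. up (reach top Bs))"
    using assms(1) \<open>W \<le> U\<close> unfolding weak_cover_def by (meson order_trans)
qed

text \<open>In a reordered chain, the part up to the visit of \<open>Sup D\<close> ends in members
  \<open>V\<close> of \<open>D\<close>; covering of these \<open>V\<close> by \<open>B\<close> is
  applied to that part, and the rest of the chain is appended again.\<close>

lemma weak_cover_trans:
  assumes "weak_cover (Sup D) U" "\<And>V. V \<in> D \<Longrightarrow> weak_cover B V"
  shows "weak_cover B U"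
  unfolding weak_cover_def
proof (intro allI impI)
  fix As :: "'a list" and W assume "W \<le> U"
  let ?S = "SUP Bs\<in>{Bs. mset Bs = mset (B # As)}. up (reach top Bs)"
  have "up (reach top Cs) \<le> ?S" if Cs: "mset Cs = mset (Sup D # As)" for Cs
  proof -
    have "Sup D \<in> set Cs" using Cs by (metis list.set_intros(1) set_mset_mset)
    then obtain xs ys where xy: "Cs = xs @ Sup D # ys" by (meson split_list)
    let ?P = "{Bs. mset Bs = mset (B # xs)}"
    have "inf (Sup D) (up (reach top xs)) = (SUP V\<in>D. inf V (up (reach top xs)))"
      using inf_Sup_frame[of "up (reach top xs)" D] by (simp add: inf.commute)
    also have "\<dots> \<le> (SUP Bs\<in>?P. up (reach top Bs))"
      using assms(2) unfolding weak_cover_def by (intro SUP_least) auto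
    also have "\<dots> = up (Sup (reach top ` ?P))" by (simp add: up_Sup image_image)
    finally have "up (reach top Cs) \<le> up (reach (Sup (reach top ` ?P)) ys)"
      using xy by (simp add: reach_append up_reach_mono)
    also have "\<dots> = (SUP Bs\<in>?P. up (reach top (Bs @ ys)))"
      by (simp add: reach_Sup up_Sup image_image reach_append)
    also have "\<dots> \<le> ?S"
    proof (rule SUP_least)
      fix Bs assume "Bs \<in> ?P"
      then have "mset (Bs @ ys) = mset (B # As)" using Cs xy by simp
      then show "up (reach top (Bs @ ys)) \<le> ?S" by (intro SUP_upper) simp
    qed
    finally show ?thesis .
  qed
  then have "(SUP Cs\<in>{Cs. mset Cs = mset (Sup D # As)}. up (reach top Cs)) \<le> ?S"
    by (intro SUP_least) auto
  then show "inf W (up (reach top As)) \<le> ?S"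
    using assms(1) \<open>W \<le> U\<close> unfolding weak_cover_def by (meson order_trans)
qed

end

section \<open>Filters of opens\<close>

definition is_filter :: "'a::frame set \<Rightarrow> bool" where
  "is_filter F \<longleftrightarrow> top \<in> F \<and> (\<forall>a\<in>F. \<forall>b\<in>F. inf a b \<in> F) \<and> (\<forall>a\<in>F. \<forall>b. a \<le> b \<longrightarrow> b \<in> F)"

lemma filter_top: "is_filter F \<Longrightarrow> top \<in> F"
  and filter_inf: "is_filter F \<Longrightarrow> a \<in> F \<Longrightarrow> b \<in> F \<Longrightarrow> inf a b \<in> F"
  and filter_up: "is_filter F \<Longrightarrow> a \<in> F \<Longrightarrow> a \<le> b \<Longrightarrow> b \<in> F"
  by (auto simp: is_filter_def)

lemma is_filter_principal: "is_filter {b. a \<le> b}"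
  by (auto simp: is_filter_def)

lemma is_filter_Union_chain:
  assumes "C \<noteq> {}" "\<And>F. F \<in> C \<Longrightarrow> is_filter F" "\<And>F G. F \<in> C \<Longrightarrow> G \<in> C \<Longrightarrow> F \<subseteq> G \<or> G \<subseteq> F"
  shows "is_filter (\<Union>C)"
  unfolding is_filter_def
proof (intro conjI ballI allI impI)
  show "top \<in> \<Union>C" using assms(1,2) filter_top by blast
  show "inf a b \<in> \<Union>C" if "a \<in> \<Union>C" "b \<in> \<Union>C" for a b
  proof -
    from that obtain F G where "F \<in> C" "G \<in> C" "a \<in> F" "b \<in> G" by blast
    then show ?thesis using assms(2,3) filter_inf by (metis Union_iff subset_iff)
  qed
  show "b \<in> \<Union>C" if "a \<in> \<Union>C" "a \<le> b" for a b using that assms(2) filter_up by blast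
qed

lemma filter_INF:
  assumes "finite I" "is_filter F" "\<And>i. i \<in> I \<Longrightarrow> h i \<in> F"
  shows "(INF i\<in>I. h i) \<in> F"
  using assms(1,3) by (induction I) (auto intro: filter_inf filter_top assms(2))

text \<open>A filter maximal among those containing \<open>U\<close> and missing \<open>G\<close> is
  prime, by distributivity.\<close>

lemma prime_filter_exists:
  fixes U G :: "'a::frame"
  assumes "\<not> U \<le> G"
  shows "\<exists>x. is_filter x \<and> U \<in> x \<and> G \<notin> x \<and> (\<forall>a b. sup a b \<in> x \<longrightarrow> a \<in> x \<or> b \<in> x)"
proof -
  let ?A = "{F. is_filter F \<and> U \<in> F \<and> G \<notin> F}"
  have "\<exists>M\<in>?A. \<forall>X\<in>?A. M \<subseteq> X \<longrightarrow> X = M"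
  proof (rule subset_Zorn_nonempty)
    show "?A \<noteq> {}" using assms is_filter_principal[of U] by auto
    show "\<Union>C \<in> ?A" if "C \<noteq> {}" "subset.chain ?A C" for C
      using that is_filter_Union_chain[of C] unfolding subset_chain_def by blast
  qed
  then obtain x where x: "is_filter x" "U \<in> x" "G \<notin> x"
    and max: "\<And>X. is_filter X \<Longrightarrow> U \<in> X \<Longrightarrow> G \<notin> X \<Longrightarrow> x \<subseteq> X \<Longrightarrow> X = x" by blast
  \<comment> \<open>By maximality, the filter generated by \<open>x\<close> and \<open>a\<close>
    must contain \<open>G\<close>.\<close>
  have witness: "\<exists>c\<in>x. inf c a \<le> G" if "a \<notin> x" for a
  proof (rule ccontr)
    assume none: "\<not> ?thesis"
    let ?X = "{b. \<exists>c\<in>x. inf c a \<le> b}"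
    have "is_filter ?X" unfolding is_filter_def
    proof (intro conjI ballI allI impI)
      show "top \<in> ?X" using filter_top[OF x(1)] by auto
      show "inf b b' \<in> ?X" if "b \<in> ?X" "b' \<in> ?X" for b b'
      proof -
        from that obtain c c' where "c \<in> x" "c' \<in> x" "inf c a \<le> b" "inf c' a \<le> b'" by blast
        moreover then have "inf (inf c c') a \<le> inf b b'"
          by (meson inf.boundedI inf.cobounded1 inf.cobounded2 inf_mono order_refl order_trans)
        ultimately show ?thesis using filter_inf[OF x(1)] by blast
      qed
      show "b' \<in> ?X" if "b \<in> ?X" "b \<le> b'" for b b' using that order_trans by blast
    qed
    moreover have "x \<subseteq> ?X" by (auto intro: le_infI1)
    moreover have "a \<in> ?X" using filter_top[OF x(1)] by auto
    ultimately show False using max[of ?X] none x(2) that by blast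
  qed
  have "a \<in> x \<or> b \<in> x" if ab: "sup a b \<in> x" for a b
  proof (rule ccontr)
    assume "\<not> ?thesis"
    then obtain c d where cd: "c \<in> x" "d \<in> x" "inf c a \<le> G" "inf d b \<le> G" using witness by blast
    have "inf (inf c d) (sup a b) \<le> G"
      using cd by (auto simp: inf_sup_frame intro: order_trans[OF inf_mono[OF inf.cobounded1 order_refl]]
          order_trans[OF inf_mono[OF inf.cobounded2 order_refl]])
    then show False using cd ab x filter_inf filter_up by metis
  qed
  then show ?thesis using x by blast
qed

section \<open>Causal relations between filters\<close>

context join_cones begin

text \<open>For filters these two halves of the causal relation differ; enlarging the source preserves
  \<open>sees\<close>, enlarging the target preserves \<open>precedes\<close>.\<close>

definition precedes :: "'a set \<Rightarrow> 'a set \<Rightarrow> bool" where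
  "precedes F G \<longleftrightarrow> (\<forall>a\<in>F. up a \<in> G)"

definition sees :: "'a set \<Rightarrow> 'a set \<Rightarrow> bool" where
  "sees F G \<longleftrightarrow> (\<forall>b\<in>G. dn b \<in> F)"

definition linked :: "'a set \<Rightarrow> 'a set \<Rightarrow> bool" where
  "linked F G \<longleftrightarrow> precedes F G \<and> sees F G"

lemma precedes_trans: "precedes F G \<Longrightarrow> precedes G H \<Longrightarrow> precedes F H"
  unfolding precedes_def by (metis up_idem)

lemma sees_trans: "sees F G \<Longrightarrow> sees G H \<Longrightarrow> sees F H"
  unfolding sees_def by (metis dn_idem)

lemma linked_trans: "linked F G \<Longrightarrow> linked G H \<Longrightarrow> linked F H"
  unfolding linked_def using precedes_trans sees_trans by blast

lemma precedes_refl: "is_filter F \<Longrightarrow> precedes F F"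
  unfolding precedes_def using filter_up up_ge by blast

lemma precedes_mono: "precedes F G \<Longrightarrow> F' \<subseteq> F \<Longrightarrow> G \<subseteq> G' \<Longrightarrow> precedes F' G'"
  unfolding precedes_def by blast

lemma sees_mono: "sees F G \<Longrightarrow> F \<subseteq> F' \<Longrightarrow> G' \<subseteq> G \<Longrightarrow> sees F' G'"
  unfolding sees_def by blast

lemma is_filter_join:
  assumes "is_filter F" "is_filter G" "\<And>c d. h (inf c d) \<le> inf (h c) (h d)"
  shows "is_filter {b. \<exists>a\<in>F. \<exists>c\<in>G. inf a (h c) \<le> b}" (is "is_filter ?X")
  unfolding is_filter_def
proof (intro conjI ballI allI impI)
  show "top \<in> ?X" using filter_top[OF assms(1)] filter_top[OF assms(2)] by auto
  show "inf b b' \<in> ?X" if "b \<in> ?X" "b' \<in> ?X" for b b'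
  proof -
    from that obtain a c a' c' where *: "a \<in> F" "a' \<in> F" "c \<in> G" "c' \<in> G"
      "inf a (h c) \<le> b" "inf a' (h c') \<le> b'" by blast
    have "inf (inf a a') (h (inf c c')) \<le> inf (inf a a') (inf (h c) (h c'))"
      using assms(3) by (intro inf_mono) auto
    also have "\<dots> \<le> inf b b'"
      using *(5,6) by (intro inf.boundedI) (auto intro: order_trans[OF inf_mono[OF inf.cobounded1 inf.cobounded1]]
        order_trans[OF inf_mono[OF inf.cobounded2 inf.cobounded2]])
    finally show ?thesis
      using filter_inf[OF assms(1) *(1,2)] filter_inf[OF assms(2) *(3,4)] by blast
  qed
  show "b' \<in> ?X" if "b \<in> ?X" "b \<le> b'" for b b' using that order_trans by blast
qed

text \<open>Starting next to the fixed end \<open>t\<close> and moving backwards, each filter is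
  enlarged by the past cones of the members of its successor.\<close>

lemma linked_lift:
  assumes "distinct w" "\<And>k. k \<in> set w \<Longrightarrow> is_filter (g k)" "is_filter t"
    "sorted_wrt precedes (map g w @ [t])"
  shows "\<exists>v. (\<forall>k\<in>set w. is_filter (v k) \<and> g k \<subseteq> v k) \<and> sorted_wrt linked (map v w @ [t])"
  using assms
proof (induction w)
  case (Cons k w)
  then obtain v where v: "\<And>k. k \<in> set w \<Longrightarrow> is_filter (v k) \<and> g k \<subseteq> v k"
    "sorted_wrt linked (map v w @ [t])" by auto
  \<comment> \<open>The successor of \<open>k\<close> in the enlarged chain, or \<open>t\<close> if
    \<open>k\<close> comes last. A link to \<open>h\<close> gives links to all later members by
    transitivity.\<close>
  define h where "h = hd (map v w @ [t])"
  have h: "is_filter h" "precedes (g k) h"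
    using Cons.prems v(1) by (cases w; force simp: h_def intro: precedes_mono)+
  have h_link: "G = h \<or> linked h G" if "G \<in> set (map v w @ [t])" for G
    using v(2) that by (cases w) (auto simp: h_def)
  \<comment> \<open>The least filter above \<open>g k\<close> that sees \<open>h\<close>;
    \<open>up_inf_dn\<close> shows that it still precedes \<open>h\<close>.\<close>
  define s where "s = {b. \<exists>a\<in>g k. \<exists>c\<in>h. inf a (dn c) \<le> b}"
  have s: "is_filter s" unfolding s_def
    using Cons.prems(2) h(1) by (intro is_filter_join) (auto intro: dn_mono)
  have "g k \<subseteq> s" unfolding s_def using filter_top[OF h(1)] by (auto intro: le_infI1)
  have "precedes s h" unfolding precedes_def
  proof
    fix b assume "b \<in> s"
    then obtain a c where ac: "a \<in> g k" "c \<in> h" "inf a (dn c) \<le> b" by (auto simp: s_def)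
    have "inf c (up a) \<in> h" using ac h filter_inf by (auto simp: precedes_def)
    moreover have "inf c (up a) \<le> up b" using up_inf_dn ac(3) up_mono order_trans by blast
    ultimately show "up b \<in> h" using h(1) filter_up by blast
  qed
  moreover have "sees s h" unfolding sees_def
  proof
    fix c assume "c \<in> h"
    moreover have "inf top (dn c) \<le> dn c" by simp
    moreover have "top \<in> g k" using filter_top[OF Cons.prems(2)[of k]] by simp
    ultimately show "dn c \<in> s" unfolding s_def by blast
  qed
  ultimately have "linked s h" by (simp add: linked_def)
  then have "linked s G" if "G \<in> set (map v w @ [t])" for G
    using h_link[OF that] linked_trans by blast
  then have "sorted_wrt linked (s # map v w @ [t])" using v(2) by simp
  moreover have "map (v(k := s)) (k # w) @ [t] = s # map v w @ [t]" using Cons.prems(1) by auto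
  ultimately have "sorted_wrt linked (map (v(k := s)) (k # w) @ [t])" by (simp only:)
  moreover have "\<forall>l\<in>set (k # w). is_filter ((v(k := s)) l) \<and> g l \<subseteq> (v(k := s)) l"
    using v(1) s \<open>g k \<subseteq> s\<close> by auto
  ultimately show ?case by blast
qed simp

end

section \<open>Weak covering at a prime filter\<close>

locale prime_point = join_cones le
  for le :: "'a::frame \<Rightarrow> 'a \<Rightarrow> bool"  (infix \<open>\<unlhd>\<close> 50) +
  fixes x :: "'a set"
  assumes x_filter: "is_filter x" and x_bot: "bot \<notin> x"
    and x_prime: "sup a b \<in> x \<Longrightarrow> a \<in> x \<or> b \<in> x"
begin

lemma x_Sup: "finite S \<Longrightarrow> Sup S \<in> x \<Longrightarrow> \<exists>a\<in>S. a \<in> x"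
proof (induction S rule: finite_induct)
  case (insert a S)
  then show ?case using x_prime[of a "Sup S"] by auto
qed (use x_bot in simp)

lemma up_reach_in_x:
  assumes "\<And>k. k \<in> set w \<Longrightarrow> is_filter (g k) \<and> precedes (g k) x \<and> f k \<in> g k"
    "sorted_wrt precedes (map g w)"
    "\<And>k. k \<in> set w \<Longrightarrow> precedes e (g k)" "precedes e x" "c \<in> e"
  shows "up (reach c (map f w)) \<in> x"
  using assms
proof (induction w arbitrary: c e)
  case Nil
  then show ?case by (auto simp: precedes_def)
next
  case (Cons k w)
  \<comment> \<open>The open reached so far belongs to \<open>g k\<close>, which takes over the part
    of \<open>e\<close>.\<close>
  have "inf (f k) (up c) \<in> g k" using Cons.prems by (auto simp: precedes_def intro: filter_inf)
  then have "up (reach (inf (f k) (up c)) (map f w)) \<in> x"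
    using Cons.prems by (intro Cons.IH[of "g k"]) auto
  then show ?case by simp
qed

text \<open>A converse of \<open>up_reach_in_x\<close>: if every choice of opens yields a chain into
  \<open>x\<close>, the filters can be enlarged to a chain in the order of \<open>w\<close>.\<close>

lemma precedes_enlarge:
  assumes "distinct w" "\<And>k. k \<in> set w \<Longrightarrow> is_filter (g k)" "is_filter e"
    "\<And>c f. c \<in> e \<Longrightarrow> (\<And>k. k \<in> set w \<Longrightarrow> f k \<in> g k) \<Longrightarrow> up (reach c (map f w)) \<in> x"
  shows "\<exists>v. (\<forall>k\<in>set w. is_filter (v k) \<and> g k \<subseteq> v k \<and> precedes (v k) x \<and> precedes e (v k)) \<and>
    sorted_wrt precedes (map v w)"
  using assms
proof (induction w arbitrary: e)
  case (Cons k w)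
  define s where "s = {b. \<exists>a\<in>g k. \<exists>c\<in>e. inf a (up c) \<le> b}"
  have s: "is_filter s" unfolding s_def
    using Cons.prems by (intro is_filter_join) (auto intro: up_mono)
  have "g k \<subseteq> s" unfolding s_def using filter_top[OF Cons.prems(3)] by (auto intro: le_infI1)
  have "precedes e s" unfolding precedes_def
  proof
    fix c assume "c \<in> e"
    moreover have "inf top (up c) \<le> up c" by simp
    moreover have "top \<in> g k" using filter_top[OF Cons.prems(2)[of k]] by simp
    ultimately show "up c \<in> s" unfolding s_def by blast
  qed
  \<comment> \<open>An open of \<open>s\<close> contains a first stage \<open>inf a (up c)\<close>
    of a chain through \<open>k\<close>, so the hypothesis for \<open>k # w\<close> passes to
    \<open>w\<close>.\<close>
  have step: "up (reach c' (map f w)) \<in> x" if "c' \<in> s" "\<And>l. l \<in> set w \<Longrightarrow> f l \<in> g l" for c' f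
  proof -
    obtain a c where ac: "a \<in> g k" "c \<in> e" "inf a (up c) \<le> c'" using \<open>c' \<in> s\<close> by (auto simp: s_def)
    have eq: "map (f(k := a)) w = map f w" using Cons.prems(1) by auto
    have "up (reach c (map (f(k := a)) (k # w))) \<in> x"
      by (rule Cons.prems(4)) (use ac that in auto)
    then have "up (reach (inf a (up c)) (map f w)) \<in> x" using eq by simp
    then show ?thesis using ac(3) filter_up[OF x_filter] up_mono reach_mono1 by blast
  qed
  have "precedes s x" unfolding precedes_def
  proof
    fix c assume "c \<in> s"
    then have "up (reach c (map (\<lambda>_. top) w)) \<in> x"
      using Cons.prems(2) by (intro step) (auto intro: filter_top)
    then show "up c \<in> x" using up_reach_le filter_up[OF x_filter] by blast
  qed
  have "\<exists>v. (\<forall>l\<in>set w. is_filter (v l) \<and> g l \<subseteq> v l \<and> precedes (v l) x \<and> precedes s (v l)) \<and>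
      sorted_wrt precedes (map v w)"
    by (rule Cons.IH[OF _ _ s step]) (use Cons.prems in auto)
  then obtain v where v: "\<And>l. l \<in> set w \<Longrightarrow> is_filter (v l) \<and> g l \<subseteq> v l \<and> precedes (v l) x \<and> precedes s (v l)"
    "sorted_wrt precedes (map v w)" by blast
  have eq: "map (v(k := s)) (k # w) = s # map v w" using Cons.prems(1) by auto
  have e_v: "precedes e (v l)" if "l \<in> set w" for l
    using v(1)[OF that] \<open>precedes e s\<close> precedes_trans by blast
  show ?case
  proof (rule exI[of _ "v(k := s)"], rule conjI)
    show "\<forall>l\<in>set (k # w). is_filter ((v(k := s)) l) \<and> g l \<subseteq> (v(k := s)) l \<and>
        precedes ((v(k := s)) l) x \<and> precedes e ((v(k := s)) l)"
      using v(1) s \<open>g k \<subseteq> s\<close> \<open>precedes e s\<close> \<open>precedes s x\<close> e_v by simp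
    show "sorted_wrt precedes (map (v(k := s)) (k # w))" unfolding eq using v by auto
  qed
qed simp

text \<open>For each choice of opens from the filters, primeness of \<open>x\<close> selects a
  permutation that works. Since there are finitely many permutations, one works for all choices, and
  the filters can be enlarged along it.\<close>

lemma weak_cover_filters:
  assumes cover: "weak_cover A U" "U \<in> x"
    and u: "distinct u" "\<And>k. k \<in> set u \<Longrightarrow> is_filter (f k) \<and> precedes (f k) x"
      "sorted_wrt precedes (map f u)"
  obtains v a where "is_filter a" "A \<in> a" "precedes a x"
    "\<And>k. k \<in> set u \<Longrightarrow> is_filter (v k) \<and> f k \<subseteq> v k \<and> precedes (v k) x"
    "\<And>k. k \<in> set u \<Longrightarrow> precedes a (v k) \<or> precedes (v k) a"
    "\<And>k l. k \<in> set u \<Longrightarrow> l \<in> set u \<Longrightarrow> precedes (v k) (v l) \<or> precedes (v l) (v k)"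
proof -
  \<comment> \<open>The label \<open>None\<close> stands for the additional visit to
    \<open>A\<close>.\<close>
  define g where "g = case_option {b. A \<le> b} f"
  define K where "K = None # map Some u"
  define P where "P = {w. mset w = mset K}"
  have g: "is_filter (g k)" if "k \<in> set K" for k
    using that u(2) by (auto simp: g_def K_def is_filter_principal)
  have P_fin: "finite P" unfolding P_def by (rule finite_mset_eq)
  have some: "\<exists>w\<in>P. up (reach top (map h w)) \<in> x" if h: "\<And>k. k \<in> set K \<Longrightarrow> h k \<in> g k" for h
  proof -
    let ?As = "map (\<lambda>k. h (Some k)) u"
    have "up (reach top ?As) \<in> x"
    proof (rule up_reach_in_x[where e = "{top}" and g = f])
      show "is_filter (f k) \<and> precedes (f k) x \<and> h (Some k) \<in> f k" if "k \<in> set u" for k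
        using u(2)[OF that] h[of "Some k"] that by (auto simp: K_def g_def)
    qed (use u x_filter filter_top in \<open>auto simp: precedes_def up_top\<close>)
    then have "inf U (up (reach top ?As)) \<in> x" using cover(2) x_filter filter_inf by blast
    moreover have "inf U (up (reach top ?As)) \<le> (SUP Bs\<in>{Bs. mset Bs = mset (A # ?As)}. up (reach top Bs))"
      using cover(1) unfolding weak_cover_def by blast
    ultimately have "(SUP Bs\<in>{Bs. mset Bs = mset (A # ?As)}. up (reach top Bs)) \<in> x"
      using filter_up x_filter by blast
    then obtain Bs where Bs: "mset Bs = mset (A # ?As)" "up (reach top Bs) \<in> x"
      using x_Sup[of "(\<lambda>Bs. up (reach top Bs)) ` {Bs. mset Bs = mset (A # ?As)}"]
        finite_mset_eq[of "A # ?As"] by blast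
    have "A # ?As = map (h(None := A)) K" by (simp add: K_def)
    then obtain w where w: "mset w = mset K" "Bs = map (h(None := A)) w"
      using Bs(1) mset_eq_map_obtain by metis
    have "(h(None := A)) k \<le> h k" for k using h[of None] by (auto simp: K_def g_def)
    then have "up (reach top Bs) \<le> up (reach top (map h w))"
      unfolding w(2) by (intro up_mono reach_mono) (auto simp: list_all2_conv_all_nth)
    then show ?thesis using Bs(2) w(1) filter_up x_filter by (auto simp: P_def)
  qed
  \<comment> \<open>Otherwise the finite meet of one bad choice per permutation would be bad for all
    of them.\<close>
  have "\<exists>w\<in>P. \<forall>h. (\<forall>k\<in>set K. h k \<in> g k) \<longrightarrow> up (reach top (map h w)) \<in> x"
  proof (rule ccontr)
    assume "\<not> ?thesis"
    then have "\<forall>w\<in>P. \<exists>h. (\<forall>k\<in>set K. h k \<in> g k) \<and> up (reach top (map h w)) \<notin> x" by blast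
    then obtain h where h: "\<And>w k. w \<in> P \<Longrightarrow> k \<in> set K \<Longrightarrow> h w k \<in> g k"
      "\<And>w. w \<in> P \<Longrightarrow> up (reach top (map (h w) w)) \<notin> x" by metis
    define h' where "h' = (\<lambda>k. INF w\<in>P. h w k)"
    have "h' k \<in> g k" if "k \<in> set K" for k
      unfolding h'_def using P_fin g h(1) that by (intro filter_INF) auto
    then obtain w where w: "w \<in> P" "up (reach top (map h' w)) \<in> x" using some by blast
    have "up (reach top (map h' w)) \<le> up (reach top (map (h w) w))"
      using w(1) by (intro up_mono reach_mono) (auto simp: list_all2_conv_all_nth h'_def intro: INF_lower)
    then show False using h(2) w x_filter filter_up by blast
  qed
  then obtain w where w: "w \<in> P"
    "\<And>h. (\<And>k. k \<in> set K \<Longrightarrow> h k \<in> g k) \<Longrightarrow> up (reach top (map h w)) \<in> x" by blast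
  have set_w: "set w = set K" using w(1) by (auto simp: P_def dest: mset_eq_setD)
  have "distinct K" using u(1) by (auto simp: K_def distinct_map)
  then have dist: "distinct w" using w(1) mset_eq_imp_distinct_iff[of w K] by (simp add: P_def)
  have "\<exists>v. (\<forall>k\<in>set w. is_filter (v k) \<and> g k \<subseteq> v k \<and> precedes (v k) x \<and> precedes {top} (v k)) \<and>
      sorted_wrt precedes (map v w)"
  proof (rule precedes_enlarge[OF dist])
    show "is_filter {top :: 'a}" by (auto simp: is_filter_def top_unique)
  qed (use g w set_w in auto)
  then obtain v where v: "\<And>k. k \<in> set K \<Longrightarrow> is_filter (v k) \<and> g k \<subseteq> v k \<and> precedes (v k) x"
    "sorted_wrt precedes (map v w)" using set_w by auto
  have comp: "precedes (v k) (v l) \<or> precedes (v l) (v k)" if kl: "k \<in> set K" "l \<in> set K" for k l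
  proof (cases "k = l")
    case True
    then show ?thesis using v(1) kl precedes_refl by blast
  next
    case False
    obtain i j where ij: "i < length w" "j < length w" "w ! i = k" "w ! j = l"
      using kl unfolding set_w[symmetric] in_set_conv_nth by blast
    then have "i < j \<or> j < i" using False by (cases i j rule: linorder_cases) auto
    then show ?thesis
      using sorted_wrt_nth_less[OF v(2), of i j] sorted_wrt_nth_less[OF v(2), of j i] ij by auto
  qed
  show thesis
  proof (rule that[of "v None" "\<lambda>k. v (Some k)"])
    show "A \<in> v None" using v(1)[of None] by (auto simp: K_def g_def)
    show "is_filter (v (Some k)) \<and> f k \<subseteq> v (Some k) \<and> precedes (v (Some k)) x" if "k \<in> set u" for k
      using v(1)[of "Some k"] that by (auto simp: K_def g_def)
  qed (use v(1) comp in \<open>auto simp: K_def\<close>)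
qed

end

section \<open>Rigid chains of filters\<close>

lemma upt_split: "i \<le> j \<Longrightarrow> j \<le> k \<Longrightarrow> [i..<k] = [i..<j] @ [j..<k]"
  by (metis le_add_diff_inverse upt_add_eq_append)

lemma sorted_wrt_map_cases:
  assumes "sorted_wrt R (map f w)" "k \<in> set w" "l \<in> set w"
  shows "k = l \<or> R (f k) (f l) \<or> R (f l) (f k)"
proof -
  obtain i j where ij: "i < length w" "j < length w" "w ! i = k" "w ! j = l"
    using assms(2,3) unfolding in_set_conv_nth by blast
  show ?thesis
    using sorted_wrt_nth_less[OF assms(1), of i j] sorted_wrt_nth_less[OF assms(1), of j i] ij
    by (cases i j rule: linorder_cases) auto
qed

section \<open>Opens chosen along lists of filters\<close>

definition meets :: "'a list \<Rightarrow> 'a set list \<Rightarrow> bool" where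
  "meets Bs Fs \<longleftrightarrow> (\<exists>Gs. subseq Gs Fs \<and> list_all2 (\<in>) Bs Gs)"

lemma meets_Nil: "meets [] Fs"
  by (simp add: meets_def)

lemma meets_append2: "meets Bs Fs \<Longrightarrow> meets Bs (Gs @ Fs)"
  unfolding meets_def using list_emb_append2 by blast

lemma meets_append_rightD: "meets (As @ Bs) Fs \<Longrightarrow> meets Bs Fs"
  unfolding meets_def list_all2_append1 by (meson list_emb_append2 subseq_order.trans subseq_order.refl)

lemma meets_append:
  assumes "meets As Fs" "meets Bs Gs"
  shows "meets (As @ Bs) (Fs @ Gs)"
proof -
  obtain Hs Ks where "subseq Hs Fs" "list_all2 (\<in>) As Hs" "subseq Ks Gs" "list_all2 (\<in>) Bs Ks"
    using assms unfolding meets_def by blast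
  then show ?thesis unfolding meets_def
    by (intro exI[of _ "Hs @ Ks"]) (simp add: list_emb_append_mono list_all2_appendI)
qed

lemma meets_map:
  assumes "\<And>i. i \<in> set w \<Longrightarrow> f i \<in> g i" "subseq (map g w) Fs"
  shows "meets (map f w) Fs"
  using assms unfolding meets_def
  by (intro exI[of _ "map g w"]) (auto simp: list_all2_conv_all_nth)

lemma list_emb_le:
  fixes zs :: "'a::order list"
  assumes "list_emb (\<lambda>B z. z \<le> B) Bs zs" "list_all2 (\<le>) zs' zs"
  shows "list_emb (\<lambda>B z. z \<le> B) Bs zs'"
  using assms
proof (induction arbitrary: zs' rule: list_emb.induct)
  case (list_emb_Cons xs ys y)
  then show ?case by (auto simp: list_all2_Cons2)
next
  case (list_emb_Cons2 x y xs ys)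
  then show ?case by (auto simp: list_all2_Cons2 intro: order_trans)
qed auto

text \<open>Filters skipped by the subsequence contribute \<open>top\<close>.\<close>

lemma meets_fill:
  assumes "meets Bs Fs" "\<And>F. F \<in> set Fs \<Longrightarrow> is_filter F"
  shows "\<exists>zs. list_all2 (\<in>) zs Fs \<and> list_emb (\<lambda>B z. z \<le> B) Bs zs"
proof -
  obtain Gs where "subseq Gs Fs" "list_all2 (\<in>) Bs Gs" using assms(1) by (auto simp: meets_def)
  then show ?thesis using assms(2)
  proof (induction arbitrary: Bs rule: list_emb.induct)
    case (list_emb_Nil Fs)
    then show ?case by (intro exI[of _ "map (\<lambda>_. top) Fs"]) (auto simp: list_all2_conv_all_nth filter_top)
  next
    case (list_emb_Cons Gs Fs F)
    obtain zs where "list_all2 (\<in>) zs Fs" "list_emb (\<lambda>B z. z \<le> B) Bs zs"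
      using list_emb_Cons.IH[OF list_emb_Cons.prems(1)] list_emb_Cons.prems(2) by auto
    then show ?case using list_emb_Cons.prems by (intro exI[of _ "top # zs"]) (auto simp: filter_top)
  next
    case (list_emb_Cons2 G F Gs Fs)
    then obtain B Bs' where B: "Bs = B # Bs'" "B \<in> G" "list_all2 (\<in>) Bs' Gs"
      by (auto simp: list_all2_Cons2)
    obtain zs where "list_all2 (\<in>) zs Fs" "list_emb (\<lambda>B z. z \<le> B) Bs' zs"
      using list_emb_Cons2.IH[OF B(3)] list_emb_Cons2.prems(2) by auto
    then show ?case using list_emb_Cons2.hyps B by (intro exI[of _ "B # zs"]) auto
  qed
qed

text \<open>Entrywise meets of two fillings serve both lists at once; this is what later allows one
  route for the chain and for \<open>p\<close>.\<close>

lemma meets_fill2: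
  assumes "meets Bs Fs" "meets Cs Fs" "\<And>F. F \<in> set Fs \<Longrightarrow> is_filter F"
  shows "\<exists>zs. list_all2 (\<in>) zs Fs \<and> list_emb (\<lambda>B z. z \<le> B) Bs zs \<and> list_emb (\<lambda>B z. z \<le> B) Cs zs"
proof -
  obtain ys zs where yz: "list_all2 (\<in>) ys Fs" "list_emb (\<lambda>B z. z \<le> B) Bs ys"
    "list_all2 (\<in>) zs Fs" "list_emb (\<lambda>B z. z \<le> B) Cs zs"
    using meets_fill[OF assms(1)] meets_fill[OF assms(2)] assms(3) by blast
  have len: "length ys = length Fs" "length zs = length Fs" using yz by (auto dest: list_all2_lengthD)
  have "list_all2 (\<in>) (map2 inf ys zs) Fs"
    using yz assms(3) len by (auto simp: list_all2_conv_all_nth intro!: filter_inf)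
  moreover have "list_all2 (\<le>) (map2 inf ys zs) ys" "list_all2 (\<le>) (map2 inf ys zs) zs"
    using len by (auto simp: list_all2_conv_all_nth)
  ultimately show ?thesis using yz list_emb_le by blast
qed

section \<open>A path and a prime filter containing its endpoint\<close>

locale path_point = prime_point le x
  for le :: "'a::frame \<Rightarrow> 'a \<Rightarrow> bool"  (infix \<open>\<unlhd>\<close> 50) and x :: "'a set" +
  fixes p :: "'a list" and A U :: 'a
  assumes path: "is_path le p" and last_le: "last p \<le> U" and cover: "weak_cover A U"
    and last_x: "last p \<in> x"
begin

definition N :: nat where "N = length p - 1"

lemma length_p: "length p = Suc N" and last_p: "last p = p ! N"
  using path by (auto simp: is_path_def N_def last_conv_nth)

lemma p_le_up: "i \<le> j \<Longrightarrow> j \<le> N \<Longrightarrow> p ! j \<le> up (p ! i)"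
  using path_le_up[OF path] length_p by auto

lemma dn_last_in: "is_filter F \<Longrightarrow> i \<le> N \<Longrightarrow> p ! i \<in> F \<Longrightarrow> dn (last p) \<in> F"
  using path_le_dn[OF path, of i N] length_p last_p filter_up by auto

text \<open>No order of the letters is recorded, since weak covering returns the filters in an
  unknown order.\<close>

definition comparable :: "nat set \<Rightarrow> (nat \<Rightarrow> 'a set) \<Rightarrow> bool" where
  "comparable L v \<longleftrightarrow> (\<forall>l\<in>L. is_filter (v l) \<and> precedes (v l) x) \<and>
    (\<forall>k\<in>L. \<forall>l\<in>L. precedes (v k) (v l) \<or> precedes (v l) (v k))"

text \<open>A rigid family is not changed by an application of weak covering.\<close>

definition rigid :: "nat set \<Rightarrow> (nat \<Rightarrow> 'a set) \<Rightarrow> bool" where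
  "rigid L s \<longleftrightarrow> (\<forall>v. comparable L v \<longrightarrow> (\<forall>l\<in>L. s l \<subseteq> v l) \<longrightarrow> (\<forall>l\<in>L. v l = s l))"

text \<open>Only \<open>sees\<close> is demanded because the first filter will be enlarged to a
  maximal one, and \<open>sees\<close> survives enlargement of the source.\<close>

definition itinerary :: "'a set list \<Rightarrow> bool" where
  "itinerary Fs \<longleftrightarrow> sorted_wrt sees Fs \<and> (\<forall>F\<in>set Fs. is_filter F \<and> dn (last p) \<in> F)"

text \<open>The index \<open>N\<close> is left out: a route receives its endpoint as a separate
  argument.\<close>

definition visits :: "'a set list \<Rightarrow> nat \<Rightarrow> bool" where
  "visits Fs l \<longleftrightarrow> meets (map ((!) p) [Suc l..<N]) Fs"

text \<open>The order \<open>l # vs\<close> of the chain is unrelated to the order of \<open>p\<close>, which is why one list \<open>Fs\<close>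
  has to serve both.\<close>

primrec scheduled :: "(nat \<Rightarrow> 'a set) \<Rightarrow> nat list \<Rightarrow> bool" where
  "scheduled s [] \<longleftrightarrow> True"
| "scheduled s (l # vs) \<longleftrightarrow>
    (\<exists>Fs. itinerary (s l # Fs) \<and> subseq (map s vs) Fs \<and> visits Fs l) \<and> scheduled s vs"

text \<open>The letters from \<open>z\<close> to \<open>N - 1\<close> have been placed, and
  \<open>u\<close> lists them in causal order.\<close>

definition stage :: "nat \<Rightarrow> nat list \<Rightarrow> (nat \<Rightarrow> 'a set) \<Rightarrow> bool" where
  "stage z u s \<longleftrightarrow> distinct u \<and> set u = {z..<N} \<and> (\<forall>l\<in>set u. p ! l \<in> s l) \<and>
    comparable (set u) s \<and> rigid (set u) s \<and> sorted_wrt precedes (map s u) \<and> scheduled s u"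

lemma visits_mono: "visits Fs k \<Longrightarrow> k \<le> l \<Longrightarrow> visits Fs l"
proof (cases "l < N")
  case True
  assume "visits Fs k" "k \<le> l"
  moreover have "[Suc k..<N] = [Suc k..<Suc l] @ [Suc l..<N]"
    using True \<open>k \<le> l\<close> by (intro upt_split) auto
  ultimately show ?thesis unfolding visits_def by (metis meets_append_rightD map_append)
qed (simp add: visits_def meets_Nil)

lemma visits_append2: "visits Fs l \<Longrightarrow> visits (Gs @ Fs) l"
  by (simp add: visits_def meets_append2)

lemma scheduled_filter: "scheduled s u \<Longrightarrow> scheduled s (filter P u)"
proof (induction u)
  case (Cons l u)
  then obtain Fs where Fs: "itinerary (s l # Fs)" "subseq (map s u) Fs" "visits Fs l" by auto
  have "subseq (map s (filter P u)) (map s u)" by (simp add: subseq_map)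
  then have "subseq (map s (filter P u)) Fs" using Fs(2) subseq_order.trans by blast
  then show ?case using Fs Cons by auto
qed simp

lemma scheduled_cong: "(\<And>l. l \<in> set u \<Longrightarrow> s l = s' l) \<Longrightarrow> scheduled s u = scheduled s' u"
proof (induction u)
  case (Cons l u)
  then have eq: "s l = s' l" "map s u = map s' u" by auto
  show ?case unfolding scheduled.simps eq using Cons by simp
qed simp

text \<open>The enlargement by \<open>linked_lift\<close> is again comparable, so rigidity shows
  that nothing was enlarged.\<close>

lemma rigid_linked:
  assumes "distinct u" "comparable (set u) s" "rigid (set u) s" "sorted_wrt precedes (map s u)"
  shows "sorted_wrt linked (map s u)"
proof -
  have "sorted_wrt precedes (map s u @ [x])"
    using assms(2,4) by (auto simp: sorted_wrt_append comparable_def)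
  then have "\<exists>v. (\<forall>l\<in>set u. is_filter (v l) \<and> s l \<subseteq> v l) \<and> sorted_wrt linked (map v u @ [x])"
    using linked_lift[of u s x] assms(1,2) x_filter by (auto simp: comparable_def)
  then obtain v where v: "\<And>l. l \<in> set u \<Longrightarrow> is_filter (v l) \<and> s l \<subseteq> v l"
    "sorted_wrt linked (map v u @ [x])" by blast
  have "comparable (set u) v" unfolding comparable_def
  proof (intro conjI ballI)
    show "is_filter (v l)" "precedes (v l) x" if "l \<in> set u" for l
      using v that by (auto simp: sorted_wrt_append linked_def)
    show "precedes (v k) (v l) \<or> precedes (v l) (v k)" if "k \<in> set u" "l \<in> set u" for k l
      using sorted_wrt_map_cases[of linked v u k l] v that precedes_refl
      by (auto simp: sorted_wrt_append linked_def)
  qed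
  then have "\<forall>l\<in>set u. v l = s l" using assms(3) v(1) by (auto simp: rigid_def)
  then have "map v u = map s u" by simp
  then show ?thesis using v(2) by (metis sorted_wrt_append)
qed

text \<open>Zorn's lemma supplies the maximality from which rigidity of an extended family
  follows.\<close>

lemma maximal_comparable_filter:
  assumes "is_filter t0" "precedes t0 x" "\<And>l. l \<in> L \<Longrightarrow> precedes t0 (s l) \<or> precedes (s l) t0"
  obtains t where "is_filter t" "t0 \<subseteq> t" "precedes t x"
    "\<And>l. l \<in> L \<Longrightarrow> precedes t (s l) \<or> precedes (s l) t"
    "\<And>t'. is_filter t' \<Longrightarrow> t \<subseteq> t' \<Longrightarrow> precedes t' x \<Longrightarrow>
      (\<And>l. l \<in> L \<Longrightarrow> precedes t' (s l) \<or> precedes (s l) t') \<Longrightarrow> t' = t"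
proof -
  let ?T = "{t. is_filter t \<and> t0 \<subseteq> t \<and> precedes t x \<and> (\<forall>l\<in>L. precedes t (s l) \<or> precedes (s l) t)}"
  have "\<exists>t\<in>?T. \<forall>t'\<in>?T. t \<subseteq> t' \<longrightarrow> t' = t"
  proof (rule subset_Zorn_nonempty)
    show "?T \<noteq> {}" using assms by blast
    fix C assume C: "C \<noteq> {}" "subset.chain ?T C"
    then have C': "\<And>t. t \<in> C \<Longrightarrow> t \<in> ?T" "\<And>F G. F \<in> C \<Longrightarrow> G \<in> C \<Longrightarrow> F \<subseteq> G \<or> G \<subseteq> F"
      unfolding subset_chain_def by blast+
    have "is_filter (\<Union>C)" using C(1) C' by (intro is_filter_Union_chain) auto
    moreover have "t0 \<subseteq> \<Union>C" using C(1) C'(1) by blast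
    moreover have "precedes (\<Union>C) x" using C'(1) by (force simp: precedes_def)
    \<comment> \<open>If \<open>s l\<close> precedes one member of \<open>C\<close>, it precedes the
      union; otherwise all members, and hence the union, precede \<open>s l\<close>.\<close>
    moreover have "precedes (\<Union>C) (s l) \<or> precedes (s l) (\<Union>C)" if "l \<in> L" for l
    proof (cases "\<exists>t\<in>C. precedes (s l) t")
      case True
      then show ?thesis by (auto simp: precedes_def)
    next
      case False
      then have "precedes t (s l)" if "t \<in> C" for t using C'(1) that \<open>l \<in> L\<close> by blast
      then show ?thesis by (auto simp: precedes_def)
    qed
    ultimately show "\<Union>C \<in> ?T" by blast
  qed
  then obtain t where t: "t \<in> ?T" "\<forall>t'\<in>?T. t \<subseteq> t' \<longrightarrow> t' = t" by (rule bexE)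
  show thesis
  proof (rule that)
    show "is_filter t" "t0 \<subseteq> t" "precedes t x" using t(1) by simp_all
    show "precedes t (s l) \<or> precedes (s l) t" if "l \<in> L" for l using t(1) that by simp
    fix t' assume t': "is_filter t'" "t \<subseteq> t'" "precedes t' x"
      "\<And>l. l \<in> L \<Longrightarrow> precedes t' (s l) \<or> precedes (s l) t'"
    have "t0 \<subseteq> t'" using t(1) t'(2) by auto
    then have "t' \<in> ?T" using t' by simp
    then show "t' = t" using t(2) t'(2) by simp
  qed
qed

text \<open>Letters in front of \<open>z\<close> travel through the chain to \<open>z\<close> and
  then follow its itinerary. Being at least \<open>z\<close>, they need only a final part of the
  entries of \<open>p\<close> visited from there.\<close>

lemma scheduled_insert:
  assumes "sorted_wrt linked (map s (ks @ z # vs))" "\<And>k. k \<in> set ks \<Longrightarrow> z \<le> k"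
    "itinerary (s z # Fs)" "subseq (map s vs) Fs" "visits Fs z" "scheduled s vs"
    "\<And>k. k \<in> set ks \<Longrightarrow> is_filter (s k) \<and> dn (last p) \<in> s k"
  shows "scheduled s (ks @ z # vs)"
  using assms(1,2,7)
proof (induction ks)
  case Nil
  then show ?case using assms by auto
next
  case (Cons k ks)
  let ?Fs = "map s ks @ s z # Fs"
  have zs: "sees F (s z)" if "F \<in> set (map s (k # ks))" for F
    using Cons.prems(1) that by (auto simp: sorted_wrt_append linked_def)
  have "sorted_wrt linked (map s (k # ks))" using Cons.prems(1) by (auto simp: sorted_wrt_append)
  then have "sorted_wrt sees (map s (k # ks))"
    by (rule sorted_wrt_mono_rel[rotated]) (simp add: linked_def)
  moreover have "sees F G" if "F \<in> set (map s (k # ks))" "G \<in> set (s z # Fs)" for F G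
    using zs[OF that(1)] that(2) assms(3) sees_trans[of F "s z" G] by (auto simp: itinerary_def)
  moreover have "sorted_wrt sees (s z # Fs)" using assms(3) by (simp add: itinerary_def)
  ultimately have "sorted_wrt sees (map s (k # ks) @ s z # Fs)"
    unfolding sorted_wrt_append by blast
  then have "itinerary (s k # ?Fs)"
    using assms(3) Cons.prems(3) by (auto simp: itinerary_def)
  moreover have "subseq (map s (ks @ z # vs)) ?Fs" using assms(4) by (simp add: list_emb_append_mono)
  moreover have "visits ?Fs k"
    using visits_append2[of Fs k "map s ks @ [s z]"] visits_mono[OF assms(5), of k] Cons.prems(2) by simp
  ultimately show ?case using Cons by auto
qed

text \<open>With \<open>m\<close> the head of the old chain, the new filter \<open>t\<close> sees filters \<open>r i\<close> containing
  \<open>p ! i\<close> for \<open>z < i < m\<close>, then \<open>s m\<close>, then the itinerary of \<open>m\<close>, which passes through the whole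
  old chain. The chain members before \<open>t\<close> are led through \<open>t\<close>.\<close>

lemma stage_step:
  assumes "stage (Suc z) u s" "z < N"
  shows "\<exists>u' s'. stage z u' s'"
proof -
  have u: "distinct u" "set u = {Suc z..<N}" "\<And>l. l \<in> set u \<Longrightarrow> p ! l \<in> s l"
    "comparable (set u) s" "rigid (set u) s" "sorted_wrt precedes (map s u)" "scheduled s u"
    using assms(1) by (auto simp: stage_def)
  have s_filter: "\<And>l. l \<in> set u \<Longrightarrow> is_filter (s l)" and s_x: "\<And>l. l \<in> set u \<Longrightarrow> precedes (s l) x"
    using u(4) by (auto simp: comparable_def)
  \<comment> \<open>For an empty chain, the endpoint \<open>N\<close> with the filter
    \<open>x\<close> plays the part of the head.\<close>
  define m where "m = (if u = [] then N else hd u)"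
  define h where "h = (if u = [] then x else s m)"
  have m: "z < m" "m \<le> N" and m_u: "u \<noteq> [] \<Longrightarrow> m \<in> set u \<and> m < N"
    using assms(2) u(2) hd_in_set[of u] by (auto simp: m_def)
  have h: "is_filter h" "p ! m \<in> h"
    using x_filter last_x last_p s_filter u(3) m_u by (auto simp: h_def m_def)
  have h_s: "precedes h (s l) \<or> h = s l" if "l \<in> set u" for l
    using u(6) that by (cases u) (auto simp: h_def m_def)
  have h_x: "precedes h x" using precedes_refl[OF x_filter] s_x m_u by (auto simp: h_def)
  let ?g = "\<lambda>i. {b. p ! i \<le> b}"
  have pre: "precedes (?g i) F" if "is_filter F" "p ! j \<in> F" "i \<le> j" "j \<le> N" for i j F
    unfolding precedes_def using filter_up[OF that(1,2)] p_le_up[OF that(3,4)] up_mono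
    by (blast intro: order_trans)
  have "sorted_wrt precedes (map ?g [z..<m] @ [h])"
    unfolding sorted_wrt_append
  proof (intro conjI ballI)
    show "sorted_wrt precedes (map ?g [z..<m])"
      using m by (auto simp: sorted_wrt_map intro!: sorted_wrt_mono_rel[OF _ sorted_wrt_upt] pre
        is_filter_principal)
    show "precedes F G" if F: "F \<in> set (map ?g [z..<m])" and G: "G \<in> set [h]" for F G
    proof -
      obtain i where i: "i < m" "F = ?g i" using F by auto
      show ?thesis unfolding i(2) using pre[OF h, of i] i(1) m(2) G by simp
    qed
  qed simp
  then have "\<exists>r. (\<forall>i\<in>set [z..<m]. is_filter (r i) \<and> ?g i \<subseteq> r i) \<and>
      sorted_wrt linked (map r [z..<m] @ [h])"
    by (intro linked_lift h(1) is_filter_principal) simp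
  then obtain r where r: "\<And>i. i \<in> set [z..<m] \<Longrightarrow> is_filter (r i) \<and> ?g i \<subseteq> r i"
    "sorted_wrt linked (map r [z..<m] @ [h])" by blast
  have r_p: "p ! i \<in> r i" if "z \<le> i" "i < m" for i using r(1)[of i] that by auto
  have upt: "[z..<m] = z # [Suc z..<m]" using m(1) upt_conv_Cons by blast
  have rz: "is_filter (r z)" "p ! z \<in> r z" "linked (r z) h"
    using r m(1) by (auto simp: upt)
  \<comment> \<open>At first the new letter stands before the whole old chain; its place may change
    as its filter grows.\<close>
  have "precedes (r z) (s l)" if "l \<in> set u" for l
    using h_s[OF that] rz(3) precedes_trans by (auto simp: linked_def)
  moreover have "precedes (r z) x" using rz(3) h_x precedes_trans by (auto simp: linked_def)
  moreover have z_u: "z \<notin> set u" using u(2) by simp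
  ultimately obtain v where v: "\<And>k. k \<in> insert z (set u) \<Longrightarrow>
      is_filter (v k) \<and> (s(z := r z)) k \<subseteq> v k \<and> precedes (v k) x"
    "\<And>k l. k \<in> insert z (set u) \<Longrightarrow> l \<in> insert z (set u) \<Longrightarrow> precedes (v k) (v l) \<or> precedes (v l) (v k)"
  proof -
    assume pr: "\<And>l. l \<in> set u \<Longrightarrow> precedes (r z) (s l)" "precedes (r z) x"
    have eq: "map (s(z := r z)) (z # u) = r z # map s u" using z_u by auto
    show thesis
    proof (rule weak_cover_filters[OF cover, of "z # u" "s(z := r z)"])
      show "U \<in> x" using last_le last_x x_filter filter_up by blast
      show "sorted_wrt precedes (map (s(z := r z)) (z # u))" unfolding eq using pr u(6) by auto
      show "is_filter ((s(z := r z)) k) \<and> precedes ((s(z := r z)) k) x" if "k \<in> set (z # u)" for k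
        using that rz pr s_filter s_x by auto
      show "distinct (z # u)" using u(1) z_u by simp
      fix w a
      assume "\<And>k. k \<in> set (z # u) \<Longrightarrow> is_filter (w k) \<and> (s(z := r z)) k \<subseteq> w k \<and> precedes (w k) x"
        "\<And>k l. k \<in> set (z # u) \<Longrightarrow> l \<in> set (z # u) \<Longrightarrow> precedes (w k) (w l) \<or> precedes (w l) (w k)"
      then show thesis using that[of w] unfolding list.set by blast
    qed
  qed
  have vs: "v l = s l" if "l \<in> set u" for l
  proof -
    have "comparable (set u) v" using v by (auto simp: comparable_def)
    moreover have "s l \<subseteq> v l" if "l \<in> set u" for l using v(1)[of l] that z_u by auto
    ultimately show ?thesis using u(5) that by (auto simp: rigid_def)
  qed
  have vz: "is_filter (v z)" "r z \<subseteq> v z" "precedes (v z) x"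
    "\<And>l. l \<in> set u \<Longrightarrow> precedes (v z) (s l) \<or> precedes (s l) (v z)"
  proof -
    show "precedes (v z) (s l) \<or> precedes (s l) (v z)" if "l \<in> set u" for l
      using v(2)[of z l] vs[OF that] that by simp
  qed (use v(1)[of z] in auto)
  obtain t where t: "is_filter t" "v z \<subseteq> t" "precedes t x"
    "\<And>l. l \<in> set u \<Longrightarrow> precedes t (s l) \<or> precedes (s l) t"
    and t_max: "\<And>t'. is_filter t' \<Longrightarrow> t \<subseteq> t' \<Longrightarrow> precedes t' x \<Longrightarrow>
      (\<And>l. l \<in> set u \<Longrightarrow> precedes t' (s l) \<or> precedes (s l) t') \<Longrightarrow> t' = t"
    using maximal_comparable_filter[of "v z" "set u" s] vz by metis
  define s' where "s' = s(z := t)"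
  \<comment> \<open>The new letter goes right after the members that precede \<open>t\<close>; by
    comparability \<open>t\<close> precedes the others.\<close>
  define u1 where "u1 = filter (\<lambda>l. precedes (s l) t) u"
  define u2 where "u2 = filter (\<lambda>l. \<not> precedes (s l) t) u"
  define u' where "u' = u1 @ z # u2"
  have s'z: "s' z = t" and s'u: "\<And>l. l \<in> set u \<Longrightarrow> s' l = s l" using z_u by (auto simp: s'_def)
  have set_u': "set u' = insert z (set u)" by (auto simp: u'_def u1_def u2_def)
  have set_u'': "set u' = {z..<N}" unfolding set_u' u(2) using assms(2) by auto
  have dist: "distinct u'" using u(1) z_u by (auto simp: u'_def u1_def u2_def)
  have map_u': "map s' u' = map s u1 @ t # map s u2"
    using z_u by (auto simp: u'_def s'_def u1_def u2_def)
  have sorted_filter: "sorted_wrt precedes (map s (filter P u))" for P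
    using u(6) by (auto simp: sorted_wrt_map intro: sorted_wrt_filter)
  have sorted': "sorted_wrt precedes (map s' u')"
    unfolding map_u' sorted_wrt_append
  proof (intro conjI ballI)
    show "sorted_wrt precedes (map s u1)" unfolding u1_def by (rule sorted_filter)
    show "sorted_wrt precedes (t # map s u2)"
      using sorted_filter t(4) by (auto simp: u2_def)
    fix F G assume "F \<in> set (map s u1)" "G \<in> set (t # map s u2)"
    then have "precedes F t" "G = t \<or> precedes t G" using t(4) by (auto simp: u1_def u2_def)
    then show "precedes F G" using precedes_trans by blast
  qed
  have comp': "comparable (set u') s'"
    using u(4) t s'z s'u unfolding set_u' comparable_def by (auto intro: precedes_refl)
  \<comment> \<open>Rigidity of the old family fixes the old members, and then maximality of
    \<open>t\<close> fixes the new one.\<close>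
  have rigid': "rigid (set u') s'" unfolding rigid_def
  proof (intro allI impI)
    fix w assume w: "comparable (set u') w" "\<forall>l\<in>set u'. s' l \<subseteq> w l"
    have "comparable (set u) w" using w(1) by (auto simp: comparable_def set_u')
    moreover have "\<forall>l\<in>set u. s l \<subseteq> w l" using w(2) s'u by (auto simp: set_u')
    ultimately have ws: "\<forall>l\<in>set u. w l = s l" using u(5) by (auto simp: rigid_def)
    moreover have "w z = t"
    proof (rule t_max)
      show "is_filter (w z)" "precedes (w z) x" using w(1) by (auto simp: comparable_def set_u')
      show "t \<subseteq> w z" using w(2) s'z by (auto simp: set_u')
      show "precedes (w z) (s l) \<or> precedes (s l) (w z)" if "l \<in> set u" for l
        using w(1) ws that by (fastforce simp: comparable_def set_u')
    qed
    ultimately show "\<forall>l\<in>set u'. w l = s' l" using s'z s'u by (auto simp: set_u')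
  qed
  have p_in: "p ! l \<in> s' l" if "l \<in> set u'" for l
    using that u(3) rz(2) vz(2) t(2) s'z s'u by (auto simp: set_u')
  \<comment> \<open>The whole old chain is passed, so the itinerary serves whichever part
    \<open>u2\<close> of it lies behind \<open>t\<close>.\<close>
  have "\<exists>Fs. itinerary (t # Fs) \<and> subseq (map s u) Fs \<and> visits Fs z"
  proof (cases "u = []")
    case True
    then have "\<not> Suc z < N" using u(2) by auto
    moreover have "dn (last p) \<in> t"
      using dn_last_in[of t z] t(1) p_in[of z] s'z assms(2) by (auto simp: set_u')
    ultimately show ?thesis
      using True t(1) by (intro exI[of _ "[]"]) (auto simp: itinerary_def visits_def meets_Nil)
  next
    case False
    then obtain vs where vs_eq: "u = m # vs" by (cases u) (auto simp: m_def)
    then obtain Gs where Gs: "itinerary (s m # Gs)" "subseq (map s vs) Gs" "visits Gs m"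
      using u(7) by auto
    have h_eq: "h = s m" using False by (simp add: h_def)
    have mN: "m < N" using m_u False by blast
    let ?R = "map r [Suc z..<m]"
    have "sorted_wrt linked (r z # ?R @ [s m])" using r(2) by (simp add: upt h_eq)
    then have "sorted_wrt sees (r z # ?R @ [s m])"
      by (rule sorted_wrt_mono_rel[rotated]) (simp add: linked_def)
    then have sees1: "sorted_wrt sees (t # ?R @ [s m])"
      using vz(2) t(2) sees_mono[of "r z" _ t] by auto
    have "sorted_wrt sees ((t # ?R) @ s m # Gs)"
      unfolding sorted_wrt_append
    proof (intro conjI ballI)
      show "sorted_wrt sees (t # ?R)" using sees1 by (auto simp: sorted_wrt_append)
      show "sorted_wrt sees (s m # Gs)" using Gs(1) by (simp add: itinerary_def)
      fix F G assume "F \<in> set (t # ?R)" "G \<in> set (s m # Gs)"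
      then have "sees F (s m)" "G = s m \<or> sees (s m) G"
        using sees1 Gs(1) by (auto simp: sorted_wrt_append itinerary_def)
      then show "sees F G" using sees_trans by blast
    qed
    then have "sorted_wrt sees (t # ?R @ s m # Gs)" by simp
    moreover have "is_filter F \<and> dn (last p) \<in> F" if F: "F \<in> set (t # ?R @ s m # Gs)" for F
    proof -
      consider "F = t" | i where "i \<in> {Suc z..<m}" "F = r i" | "F \<in> set (s m # Gs)" using F by auto
      then show ?thesis
      proof cases
        case 1
        then show ?thesis using dn_last_in[of t z] t(1) p_in[of z] s'z assms(2) by (auto simp: set_u')
      next
        case (2 i)
        then show ?thesis using dn_last_in[of "r i" i] r(1)[of i] m(2) by auto
      next
        case 3
        then show ?thesis using Gs(1) by (auto simp: itinerary_def)
      qed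
    qed
    ultimately have "itinerary (t # ?R @ s m # Gs)" unfolding itinerary_def by blast
    moreover have "subseq (map s u) (?R @ s m # Gs)" using Gs(2) vs_eq by (simp add: list_emb_append2)
    moreover have "visits (?R @ s m # Gs) z"
    proof -
      have "[Suc z..<N] = [Suc z..<m] @ m # [Suc m..<N]"
        using m(1) mN upt_split[of "Suc z" m N] upt_conv_Cons[of m N] by simp
      moreover have "meets (map ((!) p) [Suc z..<m]) ?R"
        by (rule meets_map[where g = r]) (auto intro: r_p)
      moreover have "meets [p ! m] [s m]"
        using u(3)[of m] vs_eq by (auto simp: meets_def intro: exI[of _ "[s m]"])
      ultimately show ?thesis
        using Gs(3) meets_append[of _ ?R _ "[s m] @ Gs"] meets_append[of "[p ! m]" "[s m]" _ Gs]
        by (simp add: visits_def)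
    qed
    ultimately show ?thesis by blast
  qed
  then obtain Fs where Fs: "itinerary (t # Fs)" "subseq (map s u) Fs" "visits Fs z" by blast
  have "scheduled s' (u1 @ z # u2)"
  proof (rule scheduled_insert)
    show "sorted_wrt linked (map s' (u1 @ z # u2))"
      using rigid_linked[OF dist comp' rigid' sorted'] by (simp add: u'_def)
    show "z \<le> k" if "k \<in> set u1" for k using that u(2) by (auto simp: u1_def)
    show "itinerary (s' z # Fs)" "visits Fs z" using Fs s'z by auto
    have "map s' u2 = map s u2" using s'u by (auto simp: u2_def)
    moreover have "subseq (map s u2) (map s u)" by (simp add: u2_def subseq_map)
    ultimately show "subseq (map s' u2) Fs" using Fs(2) subseq_order.trans by metis
    have "scheduled s u2" using u(7) by (simp add: u2_def scheduled_filter)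
    moreover have "scheduled s u2 = scheduled s' u2"
      by (rule scheduled_cong) (use s'u in \<open>auto simp: u2_def\<close>)
    ultimately show "scheduled s' u2" by simp
    show "is_filter (s' k) \<and> dn (last p) \<in> s' k" if "k \<in> set u1" for k
      using that s'u s_filter[of k] dn_last_in[of "s k" k] u(2,3) by (auto simp: u1_def)
  qed
  then have "stage z u' s'"
    using dist set_u'' p_in comp' rigid' sorted' by (simp add: stage_def u'_def)
  then show ?thesis by blast
qed

lemma stage_0: "\<exists>u s. stage 0 u s"
proof -
  have "\<exists>u s. stage (N - k) u s" if "k \<le> N" for k
    using that
  proof (induction k)
    case 0
    then show ?case
      by (intro exI[of _ "[]"]) (auto simp: stage_def comparable_def rigid_def)
  next
    case (Suc k)
    then have "Suc (N - Suc k) = N - k" by simp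
    then show ?case using Suc stage_step[of "N - Suc k"] by auto
  qed
  from this[of N] show ?thesis by simp
qed

section \<open>From filters back to paths\<close>

text \<open>Backwards from \<open>dn (last p)\<close>, which every filter of an itinerary contains,
  \<open>sees\<close> carries past cones from each filter to the one before.\<close>

lemma route_in_filter:
  assumes "itinerary (F # Fs)" "list_all2 (\<in>) zs Fs"
  shows "route zs (last p) \<in> F"
  using assms
proof (induction zs arbitrary: F Fs)
  case Nil
  then show ?case by (simp add: itinerary_def)
next
  case (Cons z zs)
  then obtain G Gs where G: "Fs = G # Gs" "z \<in> G" "list_all2 (\<in>) zs Gs"
    by (auto simp: list_all2_Cons1)
  then have "route zs (last p) \<in> G" using Cons by (auto simp: itinerary_def)
  then have "inf z (route zs (last p)) \<in> G"
    using G Cons.prems(1) filter_inf by (auto simp: itinerary_def)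
  then show ?case using Cons.prems(1) G(1) by (auto simp: itinerary_def sees_def)
qed

text \<open>The counterpart of \<open>scheduled\<close> for opens, with stops \<open>zs\<close> in
  place of the filters of an itinerary.\<close>

primrec anchored :: "(nat \<Rightarrow> 'a) \<Rightarrow> nat list \<Rightarrow> bool" where
  "anchored S [] \<longleftrightarrow> True"
| "anchored S (l # vs) \<longleftrightarrow>
    (\<exists>zs. S l \<le> route zs (last p) \<and> list_emb (\<lambda>B z. z \<le> B) (map S vs) zs \<and>
      list_emb (\<lambda>B z. z \<le> B) (map ((!) p) [Suc l..<N]) zs) \<and> anchored S vs"

lemma anchored_cong: "(\<And>l. l \<in> set u \<Longrightarrow> S l = S' l) \<Longrightarrow> anchored S u = anchored S' u"
proof (induction u)
  case (Cons l u)
  then have eq: "S l = S' l" "map S u = map S' u" by auto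
  show ?case unfolding anchored.simps eq using Cons by simp
qed simp

lemma anchored_exists:
  assumes "distinct u" "scheduled s u" "\<And>l. l \<in> set u \<Longrightarrow> is_filter (s l) \<and> p ! l \<in> s l"
  shows "\<exists>S. (\<forall>l\<in>set u. S l \<in> s l \<and> S l \<le> p ! l) \<and> anchored S u"
  using assms
proof (induction u)
  case (Cons l vs)
  then obtain S where S: "\<And>k. k \<in> set vs \<Longrightarrow> S k \<in> s k \<and> S k \<le> p ! k" "anchored S vs" by auto
  obtain Fs where Fs: "itinerary (s l # Fs)" "subseq (map s vs) Fs" "visits Fs l"
    using Cons.prems(2) by auto
  have "meets (map S vs) Fs" by (rule meets_map[OF _ Fs(2)]) (use S in auto)
  moreover have "meets (map ((!) p) [Suc l..<N]) Fs" using Fs(3) by (simp add: visits_def)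
  moreover have "is_filter F" if "F \<in> set Fs" for F using Fs(1) that by (auto simp: itinerary_def)
  ultimately obtain zs where zs: "list_all2 (\<in>) zs Fs" "list_emb (\<lambda>B z. z \<le> B) (map S vs) zs"
    "list_emb (\<lambda>B z. z \<le> B) (map ((!) p) [Suc l..<N]) zs"
    using meets_fill2 by metis
  \<comment> \<open>Chosen after the opens of \<open>vs\<close>, because the stops \<open>zs\<close>
    depend on those.\<close>
  define B where "B = inf (p ! l) (route zs (last p))"
  have B: "B \<in> s l" unfolding B_def using route_in_filter[OF Fs(1) zs(1)] Cons.prems(3) filter_inf by auto
  have eq: "map (S(l := B)) vs = map S vs" using Cons.prems(1) by auto
  have "anchored (S(l := B)) vs = anchored S vs"
    by (rule anchored_cong) (use Cons.prems(1) in auto)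
  moreover have "B \<le> route zs (last p)" by (simp add: B_def)
  ultimately have "anchored (S(l := B)) (l # vs)"
    unfolding anchored.simps eq using S(2) zs(2,3) by auto
  moreover have "\<forall>k\<in>set (l # vs). (S(l := B)) k \<in> s k \<and> (S(l := B)) k \<le> p ! k"
    using S(1) B by (auto simp: B_def)
  ultimately show ?case by blast
qed simp

lemma anchored_split:
  "anchored S (us @ l # vs) \<Longrightarrow> \<exists>zs. S l \<le> route zs (last p) \<and>
    list_emb (\<lambda>B z. z \<le> B) (map S vs) zs \<and> list_emb (\<lambda>B z. z \<le> B) (map ((!) p) [Suc l..<N]) zs"
  by (induction us) auto

lemma restrict_top: "path_restrict le p T ! N = T"
  using path_restrict_last[of p le T] path by (simp add: is_path_def N_def)

lemma restrict_nth: "l < N \<Longrightarrow> path_restrict le p T ! l = inf (p ! l) (dn (path_restrict le p T ! Suc l))"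
  using path_restrict_nth[of l p le T] length_p by simp

text \<open>Unfolds the recursion of the restriction; this is how routes control refinement.\<close>

lemma restrict_route:
  assumes "l < N"
  shows "path_restrict le p T ! l = inf (p ! l) (route (map ((!) p) [Suc l..<N]) T)"
  using assms
proof (induction "N - l" arbitrary: l)
  case (Suc k)
  show ?case
  proof (cases "Suc l < N")
    case True
    then have "path_restrict le p T ! Suc l = inf (p ! Suc l) (route (map ((!) p) [Suc (Suc l)..<N]) T)"
      using Suc by (intro Suc.hyps(1)) auto
    moreover have "[Suc l..<N] = Suc l # [Suc (Suc l)..<N]" using True upt_conv_Cons by blast
    ultimately show ?thesis using restrict_nth[OF Suc.prems] by simp
  next
    case False
    then have "Suc l = N" using Suc.prems by simp
    then show ?thesis using restrict_nth[OF Suc.prems] restrict_top by simp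
  qed
qed simp

text \<open>Entries of \<open>p\<close> up to the last one that precedes \<open>a\<close> can be visited in their original order
  before \<open>a\<close>; all others come after \<open>a\<close>.\<close>

lemma insertion_point:
  obtains u s a h where "distinct u" "set u = {h..<N}" "h \<le> N" "scheduled s u"
    "\<And>l. l \<in> set u \<Longrightarrow> is_filter (s l) \<and> p ! l \<in> s l \<and> precedes a (s l) \<and> precedes (s l) x"
    "sorted_wrt precedes (map s u)"
    "is_filter a" "A \<in> a" "precedes a x" "h = 0 \<or> up (p ! (h - 1)) \<in> a"
proof -
  obtain w s where w: "stage 0 w s" using stage_0 by blast
  then have set_w: "set w = {0..<N}" and sched: "distinct w" "scheduled s w" "sorted_wrt precedes (map s w)"
    and s: "\<And>l. l < N \<Longrightarrow> is_filter (s l) \<and> p ! l \<in> s l \<and> precedes (s l) x"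
    and rig: "rigid (set w) s"
    by (auto simp: stage_def comparable_def)
  have "\<exists>a. is_filter a \<and> A \<in> a \<and> precedes a x \<and> (\<forall>l<N. precedes a (s l) \<or> precedes (s l) a)"
  proof (rule weak_cover_filters[OF cover, of w s])
    show "U \<in> x" using last_le last_x x_filter filter_up by blast
    show "distinct w" "sorted_wrt precedes (map s w)" using sched by auto
    show "is_filter (s k) \<and> precedes (s k) x" if "k \<in> set w" for k using s that set_w by simp
    fix v a
    assume a: "is_filter a" "A \<in> a" "precedes a x"
      and v: "\<And>k. k \<in> set w \<Longrightarrow> is_filter (v k) \<and> s k \<subseteq> v k \<and> precedes (v k) x"
      "\<And>k. k \<in> set w \<Longrightarrow> precedes a (v k) \<or> precedes (v k) a"
      "\<And>k l. k \<in> set w \<Longrightarrow> l \<in> set w \<Longrightarrow> precedes (v k) (v l) \<or> precedes (v l) (v k)"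
    have "comparable (set w) v" using v unfolding comparable_def by blast
    then have "\<forall>l\<in>set w. v l = s l" using rig v(1) unfolding rigid_def by blast
    then show ?thesis using a v(2) set_w by (intro exI[of _ a]) auto
  qed
  then obtain a where a: "is_filter a" "A \<in> a" "precedes a x"
    "\<And>l. l < N \<Longrightarrow> precedes a (s l) \<or> precedes (s l) a" by blast
  define E where "E = {l. l < N \<and> precedes (s l) a}"
  \<comment> \<open>One past the last letter that precedes \<open>a\<close>; from there on,
    comparability forces \<open>a\<close> to precede.\<close>
  define h where "h = (if E = {} then 0 else Suc (Max E))"
  have E_fin: "finite E" by (simp add: E_def)
  have h1: "h \<le> N" "h = 0 \<or> up (p ! (h - 1)) \<in> a"
  proof -
    have "Max E < N \<and> up (p ! Max E) \<in> a" if "E \<noteq> {}"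
    proof -
      have "Max E \<in> E" using Max_in[OF E_fin that] .
      then show ?thesis using s[of "Max E"] unfolding E_def precedes_def by simp
    qed
    then show "h \<le> N" "h = 0 \<or> up (p ! (h - 1)) \<in> a" by (auto simp: h_def Suc_le_eq)
  qed
  have h2: "precedes a (s l)" if "h \<le> l" "l < N" for l
  proof -
    have "l \<notin> E" using Max_ge[OF E_fin, of l] that(1) by (auto simp: h_def split: if_splits)
    then show ?thesis using a(4)[OF that(2)] that(2) by (simp add: E_def)
  qed
  show thesis
  proof (rule that[of "filter (\<lambda>l. h \<le> l) w" h s a])
    show "sorted_wrt precedes (map s (filter (\<lambda>l. h \<le> l) w))"
      using sched(3) by (auto simp: sorted_wrt_map intro: sorted_wrt_filter)
    show "scheduled s (filter (\<lambda>l. h \<le> l) w)" using sched(2) by (rule scheduled_filter)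
    show "set (filter (\<lambda>l. h \<le> l) w) = {h..<N}" using set_w by auto
    show "is_filter (s l) \<and> p ! l \<in> s l \<and> precedes a (s l) \<and> precedes (s l) x"
      if "l \<in> set (filter (\<lambda>l. h \<le> l) w)" for l
      using that s[of l] h2[of l] set_w by simp
  qed (use sched(1) h1 a(1-3) in simp_all)
qed

text \<open>The path follows \<open>p\<close> before \<open>h\<close>, visits \<open>A\<close>, and
  then visits opens of the filters in chain order. These opens are anchored to routes through the
  remaining entries of \<open>p\<close>.\<close>

lemma refining_path:
  obtains c where "is_path le c" "last c \<in> x" "last c \<le> last p" "inhabits c A"
    "path_refines c (path_restrict le p (last c))"
proof -
  obtain u s a h where u: "distinct u" "set u = {h..<N}" "h \<le> N" "scheduled s u"
    and s: "\<And>l. l \<in> set u \<Longrightarrow> is_filter (s l) \<and> p ! l \<in> s l \<and> precedes a (s l) \<and> precedes (s l) x"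
    and sorted: "sorted_wrt precedes (map s u)"
    and a: "is_filter a" "A \<in> a" "precedes a x" and h: "h = 0 \<or> up (p ! (h - 1)) \<in> a"
    using insertion_point by metis
  obtain S where S: "\<And>l. l \<in> set u \<Longrightarrow> S l \<in> s l \<and> S l \<le> p ! l" "anchored S u"
    using anchored_exists[OF u(1,4)] s by blast
  define Bs where "Bs = map ((!) p) [0..<h] @ A # map S u"
  define T where "T = inf (last p) (up (reach top Bs))"
  define R where "R = path_restrict le p T"
  let ?g = "\<lambda>i. {b. p ! i \<le> b}"
  \<comment> \<open>Pairs of a filter and an open chosen from it serve as labels for
    \<open>up_reach_in_x\<close>.\<close>
  define w where "w = map (\<lambda>i. (?g i, p ! i)) [0..<h] @ (a, A) # map (\<lambda>l. (s l, S l)) u"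
  have g_a: "precedes (?g i) a" if "i < h" for i
  proof -
    have "p ! (h - 1) \<le> up (p ! i)" using that u(3) by (intro p_le_up) auto
    then have "up (p ! (h - 1)) \<le> up b" if "p ! i \<le> b" for b
      using up_mono up_idem that by (metis order_trans)
    then show ?thesis using h a(1) filter_up that by (auto simp: precedes_def)
  qed
  have "up (reach top (map snd w)) \<in> x"
  proof (rule up_reach_in_x[where g = fst and e = "{top}"])
    show "is_filter (fst k) \<and> precedes (fst k) x \<and> snd k \<in> fst k" if "k \<in> set w" for k
      using that a s S(1) g_a precedes_trans[OF g_a a(3)] is_filter_principal by (auto simp: w_def)
    have "sorted_wrt precedes (map ?g [0..<h])"
      unfolding sorted_wrt_map
    proof (rule sorted_wrt_mono_rel[OF _ sorted_wrt_upt])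
      show "precedes (?g i) (?g j)" if "i \<in> set [0..<h]" "j \<in> set [0..<h]" "i < j" for i j
        using p_le_up[of i j] that u(3) up_mono by (auto simp: precedes_def intro: order_trans)
    qed
    moreover have "precedes F G" if "F \<in> set (map ?g [0..<h])" "G \<in> set (a # map s u)" for F G
      using that g_a s precedes_trans[OF g_a, of _ "s _"] by auto
    moreover have "sorted_wrt precedes (a # map s u)" using s sorted by auto
    ultimately have "sorted_wrt precedes (map ?g [0..<h] @ a # map s u)"
      unfolding sorted_wrt_append by blast
    moreover have "map fst w = map ?g [0..<h] @ a # map s u" by (simp add: w_def comp_def)
    ultimately show "sorted_wrt precedes (map fst w)" by simp
    show "precedes {top} (fst k)" if "k \<in> set w" for k
      using that a(1) s is_filter_principal filter_top by (fastforce simp: w_def precedes_def up_top)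
    show "precedes {top} x" using x_filter filter_top by (auto simp: precedes_def up_top)
  qed simp
  moreover have "map snd w = Bs" by (simp add: w_def Bs_def comp_def)
  ultimately have T: "T \<in> x" unfolding T_def using last_x x_filter filter_inf by auto
  then have "T \<noteq> bot" using x_bot by auto
  then obtain c where c: "is_path le c" "length c = Suc (length Bs)" "last c = T"
    "\<And>i. i < length Bs \<Longrightarrow> c ! i \<le> reach top (take (Suc i) Bs)"
    using path_through[of T Bs] by (auto simp: T_def)
  have len: "length Bs = Suc (h + length u)" by (simp add: Bs_def)
  have c_le: "c ! i \<le> Bs ! i" if "i < length Bs" for i
  proof -
    have "reach top (take (Suc i) Bs) \<le> Bs ! i"
      using that by (simp add: take_Suc_conv_app_nth reach_append)
    then show ?thesis using c(4) that order_trans by blast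
  qed
  have "Bs ! h = A" by (simp add: Bs_def nth_append)
  then have inh: "inhabits c A" unfolding inhabits_def using c_le[of h] c(2) len by (intro exI[of _ h]) auto
  \<comment> \<open>These entries may be met in any order, but after \<open>A\<close>; the bound on
    \<open>m\<close> starts the induction for the earlier ones.\<close>
  have late: "\<exists>m>h. m < length c \<and> c ! m \<le> R ! l" if l: "h \<le> l" "l \<le> N" for l
  proof (cases "l = N")
    case True
    have "c ! length Bs = T" using c(2,3) by (metis diff_Suc_1 last_conv_nth length_0_conv nat.simps(3))
    then show ?thesis using True c(2) len restrict_top[of T] by (intro exI[of _ "length Bs"]) (auto simp: R_def)
  next
    case False
    then have "l \<in> set u" using u(2) l by auto
    then obtain us vs where uv: "u = us @ l # vs" by (meson split_list)
    define Cs where "Cs = map ((!) p) [0..<h] @ A # map S us @ [S l]"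
    define X where "X = reach top Cs"
    have Bs: "Bs = Cs @ map S vs" by (simp add: Bs_def Cs_def uv)
    obtain zs where zs: "S l \<le> route zs (last p)" "list_emb (\<lambda>B z. z \<le> B) (map S vs) zs"
      "list_emb (\<lambda>B z. z \<le> B) (map ((!) p) [Suc l..<N]) zs"
      using anchored_split[of S us l vs] S(2) uv by auto
    have X_le: "X \<le> S l" by (simp add: X_def Cs_def reach_append)
    \<comment> \<open>A route along \<open>zs\<close> also completes the chain, so it ends in
      \<open>T\<close>. Forgetting all stops but the entries of \<open>p\<close> then gives the
      restriction.\<close>
    then have "X \<le> route zs (inf (last p) (up (reach X (map S vs))))"
      using zs by (intro route_reach) auto
    moreover have "reach X (map S vs) = reach top Bs" by (simp add: X_def Bs reach_append)
    ultimately have "X \<le> route zs T" by (simp add: T_def)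
    also have "\<dots> \<le> route (map ((!) p) [Suc l..<N]) T" using zs(3) by (rule route_emb)
    finally have "X \<le> R ! l"
      using restrict_route[of l T] X_le S(1)[OF \<open>l \<in> set u\<close>] False l(2) by (auto simp: R_def)
    moreover have "c ! (Suc h + length us) \<le> X"
      using c(4)[of "Suc h + length us"] len uv by (simp add: X_def Bs Cs_def)
    ultimately show ?thesis using c(2) len uv by (intro exI[of _ "Suc h + length us"]) auto
  qed
  \<comment> \<open>Before \<open>h\<close> the path keeps the order of \<open>p\<close>, so
    backward induction matches the recursion of the restriction.\<close>
  have early: "c ! l \<le> R ! l" if "l < h" for l
    using that
  proof (induction "h - l" arbitrary: l)
    case (Suc k)
    have "\<exists>m\<ge>l. m < length c \<and> c ! m \<le> R ! Suc l"
    proof (cases "Suc l < h")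
      case True
      then show ?thesis using Suc c(2) len by (intro exI[of _ "Suc l"]) auto
    next
      case False
      then show ?thesis using late[of "Suc l"] Suc.prems u(3) by (metis Suc_leI leI less_imp_le_nat less_le_trans nat_less_le order_trans)
    qed
    then obtain m where m: "l \<le> m" "m < length c" "c ! m \<le> R ! Suc l" by blast
    then have "c ! l \<le> dn (R ! Suc l)" using path_le_dn[OF c(1) m(1,2)] dn_mono order_trans by blast
    moreover have "c ! l \<le> p ! l"
      using c_le[of l] Suc.prems len by (auto simp: Bs_def nth_append)
    ultimately show ?case using restrict_nth[of l T] Suc.prems u(3) by (auto simp: R_def)
  qed simp
  have "path_refines c R" unfolding path_refines_def
  proof (intro allI impI)
    fix l assume "l < length R"
    then have "l \<le> N" using length_path_restrict[of le p T] length_p by (simp add: R_def)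
    show "\<exists>m<length c. c ! m \<le> R ! l"
    proof (cases "l < h")
      case True
      then show ?thesis using early c(2) len by (intro exI[of _ l]) auto
    next
      case False
      then show ?thesis using late[of l] \<open>l \<le> N\<close> by auto
    qed
  qed
  then show thesis
    using that[of c] c(1,3) T inh by (auto simp: T_def R_def)
qed

end

lemma (in join_cones) weak_cover_past_Cov:
  assumes cover: "weak_cover A U" and A: "A \<le> dn U"
  shows "A \<in> past_Cov le U"
  unfolding past_Cov_def
proof (intro CollectI conjI A allI impI)
  fix p assume p: "is_path le p \<and> lands_in p U"
  \<comment> \<open>All suitable paths at once, so that only the join of their endpoints remains to
    be checked.\<close>
  define Q where "Q = {c. is_path le c \<and> last c \<le> last p \<and> inhabits c A \<and>
    path_refines c (path_restrict le p (last c))}"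
  have "last p \<le> (SUP c\<in>Q. last c)"
  proof (rule ccontr)
    assume "\<not> ?thesis"
    then obtain x where x: "is_filter x" "last p \<in> x" "(SUP c\<in>Q. last c) \<notin> x"
      "\<And>a b. sup a b \<in> x \<Longrightarrow> a \<in> x \<or> b \<in> x" using prime_filter_exists by metis
    have "bot \<notin> x" using x(1,3) filter_up bot_least by blast
    then interpret path_point le x p A U
      using p x cover by unfold_locales (auto simp: lands_in_def)
    obtain c where "c \<in> Q" "last c \<in> x" using refining_path by (auto simp: Q_def)
    then show False using x(1,3) filter_up SUP_upper by metis
  qed
  moreover have "(SUP c\<in>Q. last c) \<le> last p" by (rule SUP_least) (simp add: Q_def)
  ultimately show "\<exists>Q. local_past_refinement le p Q \<and> (\<forall>q\<in>Q. inhabits q A)"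
    by (intro exI[of _ Q]) (auto simp: local_past_refinement_def Q_def)
qed

section \<open>The Grothendieck topology\<close>

text \<open>Restricting a path to its own endpoint does not shrink it, so the path alone is a
  refinement of itself.\<close>

lemma (in join_cones) past_Cov_max: "dn U \<in> past_Cov le U"
  unfolding past_Cov_def
proof (intro CollectI conjI allI impI order_refl)
  fix p assume p: "is_path le p \<and> lands_in p U"
  then have p_ne: "p \<noteq> []" by (simp add: is_path_def)
  have "path_refines p (path_restrict le p (last p))"
    unfolding path_refines_def length_path_restrict
  proof (intro allI impI)
    fix n assume n: "n < length p"
    have "p ! n \<le> path_restrict le p (last p) ! n"
      using n
    proof (induction "length p - n" arbitrary: n)
      case (Suc k)
      show ?case
      proof (cases "Suc n < length p")
        case True
        then have "p ! Suc n \<le> path_restrict le p (last p) ! Suc n" using Suc by simp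
        moreover have "p ! n \<le> dn (p ! Suc n)" using p True path_le_dn[of p n "Suc n"] by simp
        ultimately have "p ! n \<le> dn (path_restrict le p (last p) ! Suc n)"
          using dn_mono order_trans by blast
        then show ?thesis using path_restrict_nth[OF True, of le "last p"] by simp
      next
        case False
        then have "n = length p - 1" using Suc.prems by simp
        then show ?thesis using path_restrict_last[OF p_ne, of le "last p"] p_ne
          by (simp add: last_conv_nth)
      qed
    qed simp
    then show "\<exists>m<length p. p ! m \<le> path_restrict le p (last p) ! n" using n by blast
  qed
  then have "local_past_refinement le p {p}" using p by (simp add: local_past_refinement_def)
  moreover have "inhabits p (dn U)"
    unfolding inhabits_def
    using p p_ne dn_ge[of U] by (intro exI[of _ "length p - 1"])
      (auto simp: lands_in_def last_conv_nth intro: order_trans)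
  ultimately show "\<exists>Q. local_past_refinement le p Q \<and> (\<forall>q\<in>Q. inhabits q (dn U))" by blast
qed

text \<open>The same refinement works: its paths end inside \<open>V\<close>, so all their entries
  lie in \<open>dn V\<close>.\<close>

lemma (in join_cones) past_Cov_inf:
  assumes "A \<in> past_Cov le U" "V \<le> U"
  shows "inf A (dn V) \<in> past_Cov le V"
  unfolding past_Cov_def
proof (intro CollectI conjI allI impI)
  fix p assume p: "is_path le p \<and> lands_in p V"
  then have "lands_in p U" using assms(2) by (auto simp: lands_in_def)
  then obtain Q where Q: "local_past_refinement le p Q" "\<forall>q\<in>Q. inhabits q A"
    using assms(1) p by (auto simp: past_Cov_def)
  have "inhabits q (inf A (dn V))" if "q \<in> Q" for q
  proof -
    obtain n where n: "n < length q" "q ! n \<le> A" using Q(2) \<open>q \<in> Q\<close> by (auto simp: inhabits_def)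
    have "is_path le q" using Q(1) \<open>q \<in> Q\<close> by (simp add: local_past_refinement_def)
    then have "q ! n \<le> dn (last q)"
      using path_le_dn[of q n "length q - 1"] n(1) by (cases "q = []") (auto simp: last_conv_nth)
    moreover have "last q \<le> V"
      using Q(1) p \<open>q \<in> Q\<close> unfolding local_past_refinement_def lands_in_def by (metis SUP_upper order_trans)
    ultimately show ?thesis
      using n dn_mono unfolding inhabits_def by (meson le_inf_iff order_trans)
  qed
  then show "\<exists>Q. local_past_refinement le p Q \<and> (\<forall>q\<in>Q. inhabits q (inf A (dn V)))"
    using Q(1) by blast
qed simp

text \<open>Passes through weak covering, where composition is possible, and back.\<close>

lemma (in join_cones) past_Cov_trans:
  assumes "Sup D \<in> past_Cov le U" "B \<le> dn U"
    "\<And>V. V \<in> D \<Longrightarrow> inf B (dn V) \<in> past_Cov le V"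
  shows "B \<in> past_Cov le U"
proof (rule weak_cover_past_Cov[OF weak_cover_trans assms(2)])
  show "weak_cover (Sup D) U" using assms(1) by (rule past_Cov_weak_cover)
  show "weak_cover B V" if "V \<in> D" for V
    using past_Cov_weak_cover[OF assms(3)[OF that]] weak_cover_mono by simp
qed

lemma past_J_iff:
  "D \<times> {past_cone le U} \<in> past_J le U \<longleftrightarrow>
    (\<forall>V\<in>D. V \<le> past_cone le U \<and> (\<forall>W\<le>V. W \<in> D)) \<and> Sup D \<in> past_Cov le U"
proof -
  have "fst ` (D \<times> {past_cone le U}) = D" by force
  moreover have "D \<times> {past_cone le U} = D' \<times> {past_cone le U} \<longleftrightarrow> D = D'" for D' by auto
  ultimately show ?thesis by (simp add: past_J_def is_sieve_poset_cat_iff)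
qed

lemma Sup_downset_inf:
  assumes "\<And>V. V \<in> D \<Longrightarrow> \<forall>W\<le>V. W \<in> D"
  shows "Sup {W \<in> D. W \<le> c} = inf (Sup D) (c :: 'a::frame)"
proof (rule antisym)
  show "Sup {W \<in> D. W \<le> c} \<le> inf (Sup D) c"
    by (auto intro!: Sup_least intro: Sup_upper)
  have "inf c (Sup D) = (SUP V\<in>D. inf c V)" by (rule inf_Sup_frame)
  also have "\<dots> \<le> Sup {W \<in> D. W \<le> c}"
    using assms by (intro SUP_least Sup_upper) (auto intro: inf_le2)
  finally show "inf (Sup D) c \<le> Sup {W \<in> D. W \<le> c}" by (simp add: inf.commute)
qed

lemma pullback_sieve_poset:
  assumes "V \<le> U"
  shows "pullback_sieve poset_cat (V, U) (D \<times> {U}) = {W \<in> D. W \<le> V} \<times> {V}"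
  using assms by (auto simp: pullback_sieve_def poset_cat_def)

theorem theorem8p17:
  fixes le :: "'a::frame \<Rightarrow> 'a \<Rightarrow> bool"
  assumes "parallel_ordered_locale le"
    and "cones_preserve_joins le"
  shows "past_Grothendieck_topology le (past_J le)"
proof -
  interpret join_cones le using assms by (simp add: join_cones_def join_cones_axioms_def)
  have Hom: "f \<in> Hom poset_cat a b \<longleftrightarrow> f = (a, b) \<and> a \<le> b" for f and a b :: 'a
    by (auto simp: Hom_def poset_cat_def)
  have Comp: "Comp poset_cat g f = (fst f, snd g)" for f g :: "'a \<times> 'a" by (simp add: poset_cat_def)
  show ?thesis
    unfolding past_Grothendieck_topology_def
  proof (intro T_mu_Grothendieck_topology.intro endofunctor.intro category_poset_cat
      endofunctor_axioms.intro T_mu_Grothendieck_topology_axioms.intro)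
    fix U :: 'a
    show "max_sieve poset_cat (dn U) \<in> past_J le U"
    proof -
      have "max_sieve poset_cat (dn U) = {V. V \<le> dn U} \<times> {dn U}"
        by (auto simp: max_sieve_def poset_cat_def)
      moreover have "Sup {V. V \<le> dn U} = dn U" by (auto intro!: antisym Sup_least Sup_upper)
      ultimately show ?thesis using past_Cov_max by (auto simp: past_J_iff)
    qed
  next
    fix U V :: 'a and S h
    assume S: "S \<in> past_J le U" and h: "h \<in> Hom poset_cat V U"
    from S have "is_sieve poset_cat (dn U) S" by (simp add: past_J_def)
    then obtain D where D: "S = D \<times> {dn U}" "\<forall>V\<in>D. V \<le> dn U \<and> (\<forall>W\<le>V. W \<in> D)"
      unfolding is_sieve_poset_cat_iff by blast
    have "V \<le> U" "h = (V, U)" using h by (auto simp: Hom)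
    have "Sup {W \<in> D. W \<le> dn V} \<in> past_Cov le V"
      using past_Cov_inf[OF _ \<open>V \<le> U\<close>, of "Sup D"] S D Sup_downset_inf[of D "dn V"]
      by (simp add: past_J_iff)
    then show "pullback_sieve poset_cat ((\<lambda>(U, V). (dn U, dn V)) h) S \<in> past_J le V"
      using \<open>h = (V, U)\<close> D dn_mono[OF \<open>V \<le> U\<close>]
      by (auto simp: pullback_sieve_poset past_J_iff intro: order_trans)
  next
    fix U :: 'a and S R
    assume S: "S \<in> past_J le U" and R: "is_sieve poset_cat (dn U) R"
      and local: "\<And>V h. h \<in> S \<Longrightarrow> h \<in> Hom poset_cat V (dn U) \<Longrightarrow>
        pullback_sieve poset_cat (Comp poset_cat (dn (dn U), dn U) ((\<lambda>(U, V). (dn U, dn V)) h)) R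
          \<in> past_J le V"
    from S have "is_sieve poset_cat (dn U) S" by (simp add: past_J_def)
    then obtain D where D: "S = D \<times> {dn U}" "\<forall>V\<in>D. V \<le> dn U \<and> (\<forall>W\<le>V. W \<in> D)"
      unfolding is_sieve_poset_cat_iff by blast
    obtain E where E: "R = E \<times> {dn U}" "\<forall>V\<in>E. V \<le> dn U \<and> (\<forall>W\<le>V. W \<in> E)"
      using R unfolding is_sieve_poset_cat_iff by blast
    have "inf (Sup E) (dn V) \<in> past_Cov le V" if "V \<in> D" for V
    proof -
      have V: "V \<le> dn U" using D(2) that by blast
      then have "dn V \<le> dn U" using dn_mono[of V "dn U"] by (simp add: dn_idem)
      \<comment> \<open>The component of the multiplication after the image of
        \<open>V \<le> dn U\<close> is the arrow from \<open>dn V\<close> to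
        \<open>dn U\<close>.\<close>
      have "pullback_sieve poset_cat (dn V, dn U) R \<in> past_J le V"
        using local[of "(V, dn U)" V] that V D(1) by (simp add: Hom Comp)
      then have "{W \<in> E. W \<le> dn V} \<times> {dn V} \<in> past_J le V"
        unfolding E(1) pullback_sieve_poset[OF \<open>dn V \<le> dn U\<close>] .
      then have "Sup {W \<in> E. W \<le> dn V} \<in> past_Cov le V" unfolding past_J_iff by blast
      moreover have "Sup {W \<in> E. W \<le> dn V} = inf (Sup E) (dn V)"
        by (rule Sup_downset_inf) (use E(2) in blast)
      ultimately show ?thesis by simp
    qed
    moreover have "Sup D \<in> past_Cov le U" using S unfolding D(1) past_J_iff by blast
    moreover have "Sup E \<le> dn U" using E(2) by (intro Sup_least) blast
    ultimately have "Sup E \<in> past_Cov le U" by (rule past_Cov_trans[rotated 2])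
    then show "R \<in> past_J le U" using E(2) unfolding E(1) past_J_iff by blast
  qed (auto simp: poset_cat_def Hom_def past_J_def dn_idem intro: dn_mono)
qed

end
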